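(* Let $n\geq 3$ and let $G$ be a simple graph on $n$ vertices whose complement $G^c$ is the cycle $C_n$. Let $m_G$ be the least common multiple of the generators $x_ix_j$, $\{i,j\}\in E(G)$, of the edge ideal $I(G)$. Then $H_*(\Delta((1,m_G)))\cong H_*(\mathbb{S}^{n-4})$, where $\Delta((1,m_G))$ is the order complex of the open interval $(1,m_G)$ in the lcm-lattice $L(I(G))$ and $\mathbb{S}^d$ denotes the $d$-dimensional sphere.
   Context: The edge ideal is $I(G)=(x_ix_j:\ \{i,j\}\in E(G))$ in a polynomial ring with variables indexed by $V(G)$; $G^c$ is the graph on $V(G)$ whose edges are the non-edges of $G$. The lcm-lattice $L(I)$ of a monomial ideal $I$ is the set of least common multiples of subsets of the minimal monomial generators (the empty subset giving $1$), ordered by divisibility. The order complex of a poset is the simplicial complex of its finite chains. *)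

theory Defs
  imports "HOL-Homology.Homology" "HOL-Library.Poly_Mapping"
begin

section \<open>Graphs and edge ideals\<close>

text \<open>A graph has the whole finite type \<open>'v\<close> as its vertex set and is given by its edges, as sets of
  vertices.\<close>

definition simple_graph :: "'v set set \<Rightarrow> bool"
  where "simple_graph E \<longleftrightarrow> (\<forall>e\<in>E. card e = 2)"

definition graph_compl :: "'v set set \<Rightarrow> 'v set set"
  where "graph_compl E = {e. card e = 2 \<and> e \<notin> E}"

text \<open>The cycle on the vertices \<open>0, \<dots>, n - 1\<close>; it is a simple graph for \<open>n \<ge> 3\<close> only.\<close>

definition cycle_edges :: "nat \<Rightarrow> nat set set"
  where "cycle_edges n = {{i, (i + 1) mod n} | i. i < n}"

definition is_cycle :: "nat \<Rightarrow> 'v set set \<Rightarrow> bool"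
  where "is_cycle n E \<longleftrightarrow> (\<exists>f. bij_betw f {..<n} (UNIV :: 'v set) \<and> E = (\<lambda>e. f ` e) ` cycle_edges n)"

text \<open>A monomial is its exponent vector, so that the product of monomials is \<open>+\<close> and the monomial
  \<open>1\<close> is \<open>0\<close>. Polynomials are finitely supported families of coefficients indexed by monomials; their
  multiplication in \<^theory>\<open>HOL-Library.Poly_Mapping\<close> is convolution.\<close>

type_synonym 'v monomial = "'v \<Rightarrow>\<^sub>0 nat"
type_synonym ('v, 'k) mpoly = "'v monomial \<Rightarrow>\<^sub>0 'k"

definition monom_poly :: "'v monomial \<Rightarrow> ('v, 'k::field) mpoly"
  where "monom_poly m = Poly_Mapping.single m 1"

definition mvar :: "'v \<Rightarrow> 'v monomial"
  where "mvar i = Poly_Mapping.single i 1"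

definition edge_monomials :: "'v set set \<Rightarrow> 'v monomial set"
  where "edge_monomials E = {mvar i + mvar j | i j. {i, j} \<in> E}"

definition ideal_gen :: "'a::comm_ring_1 set \<Rightarrow> 'a set"
  where "ideal_gen S = module.span (*) S"

definition edge_ideal :: "'v set set \<Rightarrow> ('v, 'k::field) mpoly set"
  where "edge_ideal E =
    ideal_gen {monom_poly (mvar i) * monom_poly (mvar j) | i j. {i, j} \<in> E}"


section \<open>The lcm-lattice\<close>

definition mon_dvd :: "'v monomial \<Rightarrow> 'v monomial \<Rightarrow> bool"
  where "mon_dvd m m' \<longleftrightarrow> (\<exists>q. m' = m + q)"

definition is_mon_lcm :: "'v monomial set \<Rightarrow> 'v monomial \<Rightarrow> bool"
  where "is_mon_lcm S m \<longleftrightarrow>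
    (\<forall>s\<in>S. mon_dvd s m) \<and> (\<forall>m'. (\<forall>s\<in>S. mon_dvd s m') \<longrightarrow> mon_dvd m m')"

text \<open>Only meaningful for sets with a common multiple, in particular for finite sets.\<close>

definition mon_lcm :: "'v monomial set \<Rightarrow> 'v monomial"
  where "mon_lcm S = (THE m. is_mon_lcm S m)"

text \<open>The minimal monomial generators of a monomial ideal are the monomials in the ideal that are
  minimal with respect to divisibility.\<close>

definition min_monomial_gens :: "('v, 'k::field) mpoly set \<Rightarrow> 'v monomial set"
  where "min_monomial_gens I =
    {m. monom_poly m \<in> I \<and> (\<forall>m'. monom_poly m' \<in> I \<and> mon_dvd m' m \<longrightarrow> m' = m)}"

definition lcm_lattice :: "('v, 'k::field) mpoly set \<Rightarrow> 'v monomial set"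
  where "lcm_lattice I = {mon_lcm S | S. S \<subseteq> min_monomial_gens I}"


section \<open>Order complexes and their geometric realization\<close>

definition open_interval :: "('a \<Rightarrow> 'a \<Rightarrow> bool) \<Rightarrow> 'a set \<Rightarrow> 'a \<Rightarrow> 'a \<Rightarrow> 'a set"
  where "open_interval r P a b = {x\<in>P. r a x \<and> x \<noteq> a \<and> r x b \<and> x \<noteq> b}"

definition order_complex :: "('a \<Rightarrow> 'a \<Rightarrow> bool) \<Rightarrow> 'a set \<Rightarrow> 'a set set"
  where "order_complex r P = {c. finite c \<and> c \<subseteq> P \<and> Complete_Partial_Order.chain r c}"

text \<open>The points of the realization are given by their barycentric coordinates. The product topology
  is the usual (coherent) topology when the complex is finite, as it is here. The empty simplex
  contributes no point.\<close>

definition realization :: "'a set set \<Rightarrow> ('a \<Rightarrow> real) topology"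
  where "realization K = subtopology (powertop_real UNIV)
    {t. (\<forall>v. 0 \<le> t v) \<and> {v. t v \<noteq> 0} \<in> K \<and> (\<Sum>v | t v \<noteq> 0. t v) = 1}"

text \<open>The unit sphere of dimension \<open>d \<ge> -1\<close> in Euclidean space of dimension \<open>d + 1\<close>;
  unlike \<^const>\<open>nsphere\<close> it covers the empty sphere of dimension \<open>-1\<close>.\<close>

definition unit_sphere :: "int \<Rightarrow> (nat \<Rightarrow> real) topology"
  where "unit_sphere d =
    subtopology (Euclidean_space (nat (d + 1))) {x. (\<Sum>i<nat (d + 1). x i ^ 2) = 1}"

lemma unit_sphere_of_nat: "unit_sphere (int d) = nsphere d"
  by (simp add: unit_sphere_def nsphere_def nat_add_distrib lessThan_Suc_atMost)

lemma topspace_unit_sphere_minus_one: "topspace (unit_sphere (- 1)) = {}"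
  by (simp add: unit_sphere_def)

end

theory Submission
  imports Defs
begin

text \<open>The lcm-lattice consists of the vertex sets that are unions of edges of \<open>G\<close>. Reading chains of
  vertex sets as superlevel sets, the order complex of the open interval is homotopy equivalent to the
  space of functions \<open>f : V \<rightarrow> \<real>\<close> whose set \<open>{f > min f}\<close> contains an edge of \<open>G\<close>. Modulo
  constants this is the complement in \<open>\<real>\<^sup>n\<^sup>-\<^sup>1\<close> of the functions for which this set is a clique of \<open>G\<^sup>c\<close>, which for
  \<open>n \<ge> 4\<close> form the cone over the cycle, a piecewise linear plane. A suitable linear map
  to \<open>\<real>\<^sup>2\<close> is a homeomorphism on this plane, so the plane is a graph over \<open>\<real>\<^sup>2\<close>, and a
  shear straightens it. The complement of a plane in \<open>\<real>\<^sup>n\<^sup>-\<^sup>1\<close> is homotopy equivalent to the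
  sphere of dimension \<open>n - 4\<close>. For \<open>n = 3\<close> both spaces are empty.\<close>

section \<open>Straight-line homotopies\<close>

lemma linear_homotopy:
  fixes f g :: "('b \<Rightarrow> real) \<Rightarrow> 'a \<Rightarrow> real"
  assumes f: "continuous_on S f" and g: "continuous_on S g"
    and T: "\<And>x \<tau>. x \<in> S \<Longrightarrow> 0 \<le> \<tau> \<Longrightarrow> \<tau> \<le> 1 \<Longrightarrow> (\<lambda>i. (1 - \<tau>) * f x i + \<tau> * g x i) \<in> T"
  shows "homotopic_with (\<lambda>_. True) (top_of_set S) (top_of_set T) f g"
proof -
  let ?h = "\<lambda>(\<tau>::real, x) i. (1 - \<tau>) * f x i + \<tau> * g x i"
  have fi: "continuous_on ({0..1} \<times> S) (\<lambda>p. f (snd p) i)"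
    and gi: "continuous_on ({0..1::real} \<times> S) (\<lambda>p. g (snd p) i)" for i
    using continuous_on_product_then_coordinatewise[OF f, of i]
      continuous_on_product_then_coordinatewise[OF g, of i]
    by (auto intro!: continuous_on_compose2[of S _ "{0..1} \<times> S" snd] continuous_on_snd continuous_on_id)
  have "continuous_on ({0..1} \<times> S) ?h"
    unfolding case_prod_beta
    by (intro continuous_on_coordinatewise_then_product continuous_intros fi gi)
  moreover have "?h \<in> {0..1} \<times> S \<rightarrow> T"
    using T by auto
  ultimately have "continuous_map (prod_topology (top_of_set {0..1}) (top_of_set S)) (top_of_set T) ?h"
    by (simp add: prod_topology_subtopology_eu)
  then show ?thesis
    unfolding homotopic_with_def by (intro exI[of _ ?h]) auto
qed

text \<open>All three equivalences used for \<open>n \<ge> 4\<close> arise this way. The sets need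
  not be convex; only the segments from a point to its image under the composition must stay
  inside.\<close>

lemma homotopy_equivalent_by_linear:
  fixes f :: "('b \<Rightarrow> real) \<Rightarrow> 'a \<Rightarrow> real" and g :: "('a \<Rightarrow> real) \<Rightarrow> 'b \<Rightarrow> real"
  assumes f: "continuous_on S f" "f ` S \<subseteq> T" and g: "continuous_on T g" "g ` T \<subseteq> S"
    and gf: "\<And>x \<tau>. x \<in> S \<Longrightarrow> 0 \<le> \<tau> \<Longrightarrow> \<tau> \<le> 1 \<Longrightarrow> (\<lambda>i. (1 - \<tau>) * x i + \<tau> * g (f x) i) \<in> S"
    and fg: "\<And>y \<tau>. y \<in> T \<Longrightarrow> 0 \<le> \<tau> \<Longrightarrow> \<tau> \<le> 1 \<Longrightarrow> (\<lambda>i. (1 - \<tau>) * y i + \<tau> * f (g y) i) \<in> T"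
  shows "top_of_set S homotopy_equivalent_space top_of_set T"
  unfolding homotopy_equivalent_space_def
proof (intro exI conjI)
  show "continuous_map (top_of_set S) (top_of_set T) f" "continuous_map (top_of_set T) (top_of_set S) g"
    using f g by auto
  have "homotopic_with (\<lambda>_. True) (top_of_set S) (top_of_set S) id (g \<circ> f)"
    using gf continuous_on_compose2[OF g(1) f] by (intro linear_homotopy) (auto simp: o_def)
  then show "homotopic_with (\<lambda>_. True) (top_of_set S) (top_of_set S) (g \<circ> f) id"
    by (rule homotopic_with_symD)
  have "homotopic_with (\<lambda>_. True) (top_of_set T) (top_of_set T) id (f \<circ> g)"
    using fg continuous_on_compose2[OF f(1) g] by (intro linear_homotopy) (auto simp: o_def)
  then show "homotopic_with (\<lambda>_. True) (top_of_set T) (top_of_set T) (f \<circ> g) id"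
    by (rule homotopic_with_symD)
qed

lemma continuous_on_Max_image:
  fixes f :: "'i \<Rightarrow> 'a::topological_space \<Rightarrow> real"
  assumes "finite I" "I \<noteq> {}" "\<And>i. i \<in> I \<Longrightarrow> continuous_on S (f i)"
  shows "continuous_on S (\<lambda>x. Max ((\<lambda>i. f i x) ` I))"
  using assms
proof (induction I rule: finite_ne_induct)
  case (insert i I)
  then show ?case
    by (auto intro!: continuous_on_max)
qed simp


section \<open>The order complex of unions of edges\<close>

text \<open>An edge above some value of \<open>f\<close> is above the least one, so any lower vertex
  \<open>v\<close> serves in place of a minimum of \<open>f\<close>.\<close>

definition edge_region :: "('v \<Rightarrow> 'v \<Rightarrow> bool) \<Rightarrow> ('v \<Rightarrow> real) set"
  where "edge_region R = {f. \<exists>u w v. R u w \<and> f v < f u \<and> f v < f w}"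

text \<open>The set where the edge interior is \<open>\<ge> c\<close> is the union of the edges contained in
  \<open>{f \<ge> c}\<close>. At a minimum of \<open>f\<close> it agrees with \<open>f\<close>.\<close>

definition edge_interior :: "('v \<Rightarrow> 'v \<Rightarrow> bool) \<Rightarrow> ('v \<Rightarrow> real) \<Rightarrow> 'v \<Rightarrow> real"
  where "edge_interior R f u = Max ((\<lambda>w. min (f u) (f w)) ` {w. R u w})"

section \<open>Upper sets and a continuous test for them\<close>

definition upper_set :: "('v \<Rightarrow> real) \<Rightarrow> 'v set \<Rightarrow> bool"
  where "upper_set f U \<longleftrightarrow> (\<forall>u\<in>U. \<forall>v\<in>-U. f v < f u)"

text \<open>A continuous function of \<open>f\<close> that vanishes exactly when \<open>U\<close> is
  not an upper set. The product of truncated gaps achieves this without sorting the values of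
  \<open>f\<close>.\<close>

definition upper_weight :: "('v \<Rightarrow> real) \<Rightarrow> 'v set \<Rightarrow> real"
  where "upper_weight f U = (\<Prod>(u, v)\<in>U \<times> -U. max 0 (f u - f v))"

lemma upper_weight_nonneg: "0 \<le> upper_weight f U"
  unfolding upper_weight_def by (intro prod_nonneg) auto

lemma max_zero_iff: "max 0 (a - b) = 0 \<longleftrightarrow> a \<le> (b::real)"
  by (auto simp: max_def)

lemma upper_weight_eq_0_iff:
  fixes f :: "'v::finite \<Rightarrow> real"
  shows "upper_weight f U = 0 \<longleftrightarrow> \<not> upper_set f U"
proof -
  have "upper_weight f U = 0 \<longleftrightarrow> (\<exists>(u, v)\<in>U \<times> -U. max 0 (f u - f v) = 0)"
    unfolding upper_weight_def by (subst prod_zero_iff) auto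
  also have "\<dots> \<longleftrightarrow> \<not> upper_set f U"
    unfolding upper_set_def by (simp add: max_zero_iff not_less Bex_def)
  finally show ?thesis .
qed

text \<open>Otherwise a vertex of \<open>U\<close> outside \<open>U'\<close> and a vertex of
  \<open>U'\<close> outside \<open>U\<close> would each have the larger value.\<close>

lemma upper_sets_nested:
  assumes "upper_set f U" "upper_set f U'"
  shows "U \<subseteq> U' \<or> U' \<subseteq> U"
  using assms unfolding upper_set_def by (metis ComplI less_asym subsetI)

text \<open>A point of the order complex is a function \<open>t\<close> on a chain of vertex sets. Superimposing the indicator
  functions of the chain with the weights \<open>t\<close> gives \<open>height t\<close>, and the chain is recovered as the
  chain of superlevel sets. The weights only need to be recovered up to a straight-line homotopy,
  so any continuous weighting of the superlevel sets serves as a homotopy inverse.\<close>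

locale union_of_edges_poset =
  fixes R :: "'v::finite \<Rightarrow> 'v \<Rightarrow> bool" and P :: "'a set" and r :: "'a \<Rightarrow> 'a \<Rightarrow> bool"
    and supp :: "'a \<Rightarrow> 'v set"
  assumes R_sym: "R u w \<Longrightarrow> R w u"
    and no_isolated: "\<exists>w. R u w"
    and finite_P: "finite P"
    and r_iff: "x \<in> P \<Longrightarrow> y \<in> P \<Longrightarrow> r x y \<longleftrightarrow> supp x \<subseteq> supp y"
    and supp_image: "supp ` P = {U. U \<noteq> {} \<and> U \<noteq> UNIV \<and> (\<forall>u\<in>U. \<exists>w\<in>U. R u w)}"
begin

abbreviation points :: "('a \<Rightarrow> real) set" where
  "points \<equiv> {t. (\<forall>x. 0 \<le> t x) \<and> {x. t x \<noteq> 0} \<in> order_complex r P \<and> (\<Sum>x | t x \<noteq> 0. t x) = 1}"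

definition height :: "('a \<Rightarrow> real) \<Rightarrow> 'v \<Rightarrow> real"
  where "height t v = (\<Sum>x\<in>P. t x * of_bool (v \<in> supp x))"

text \<open>The superlevel sets of \<open>f\<close> may all fail to be unions of edges. Those of the
  edge interior supply enough sets for the normalising sum to be positive on
  \<open>edge_region R\<close>.\<close>

definition weights :: "('v \<Rightarrow> real) \<Rightarrow> 'a \<Rightarrow> real"
  where "weights f x = (if x \<in> P then
    upper_weight (edge_interior R f) (supp x) / (\<Sum>y\<in>P. upper_weight (edge_interior R f) (supp y)) else 0)"

lemma supp_P: "x \<in> P \<Longrightarrow> supp x \<noteq> {} \<and> supp x \<noteq> UNIV \<and> (\<forall>u\<in>supp x. \<exists>w\<in>supp x. R u w)"
  using supp_image by blast

lemma points_iff: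
  "t \<in> points \<longleftrightarrow> (\<forall>x. 0 \<le> t x) \<and> (\<forall>x. x \<notin> P \<longrightarrow> t x = 0) \<and> (\<Sum>x\<in>P. t x) = 1
    \<and> (\<forall>x\<in>P. \<forall>y\<in>P. t x \<noteq> 0 \<longrightarrow> t y \<noteq> 0 \<longrightarrow> supp x \<subseteq> supp y \<or> supp y \<subseteq> supp x)"
proof (cases "\<forall>x. x \<notin> P \<longrightarrow> t x = 0")
  case True
  then have sub: "{x. t x \<noteq> 0} \<subseteq> P"
    by auto
  then have "(\<Sum>x | t x \<noteq> 0. t x) = (\<Sum>x\<in>P. t x)"
    using finite_P by (intro sum.mono_neutral_left) auto
  moreover have "{x. t x \<noteq> 0} \<in> order_complex r P \<longleftrightarrow>
      (\<forall>x\<in>P. \<forall>y\<in>P. t x \<noteq> 0 \<longrightarrow> t y \<noteq> 0 \<longrightarrow> supp x \<subseteq> supp y \<or> supp y \<subseteq> supp x)"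
    using sub finite_subset[OF sub finite_P]
    by (auto simp: order_complex_def Complete_Partial_Order.chain_def r_iff subset_eq)
  ultimately show ?thesis
    using True by auto
next
  case False
  then show ?thesis
    by (auto simp: order_complex_def)
qed

section \<open>From functions to chains: superlevel sets of the edge interior\<close>

lemma edge_interior_attained:
  obtains w where "R u w" "edge_interior R f u = min (f u) (f w)"
proof -
  have "edge_interior R f u \<in> (\<lambda>w. min (f u) (f w)) ` {w. R u w}"
    unfolding edge_interior_def using no_isolated[of u] by (intro Max_in) auto
  then show ?thesis
    using that by auto
qed

lemma edge_interior_ge: "R u w \<Longrightarrow> min (f u) (f w) \<le> edge_interior R f u"
  unfolding edge_interior_def by (intro Max_ge) auto

lemma edge_interior_le: "edge_interior R f u \<le> f u"
  by (metis edge_interior_attained min.cobounded1)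

text \<open>A neighbour \<open>w\<close> attaining the maximum at \<open>u\<close> works, since
  \<open>u\<close> is in turn a candidate in the maximum at \<open>w\<close>. Hence superlevel sets
  of the edge interior have no isolated vertices.\<close>

lemma edge_interior_neighbour:
  obtains w where "R u w" "edge_interior R f u \<le> edge_interior R f w"
  by (metis R_sym edge_interior_attained edge_interior_ge min.commute)

lemma edge_interior_eq:
  assumes "\<And>u. \<exists>w. R u w \<and> f u \<le> f w"
  shows "edge_interior R f = f"
proof
  fix u
  show "edge_interior R f u = f u"
    using assms[of u] edge_interior_ge[of u _ f] edge_interior_le[of f u] by fastforce
qed

text \<open>The set where the edge interior is maximal serves. It is a union of edges by
  \<open>edge_interior_neighbour\<close>, and it omits \<open>v\<close> because the edge
  \<open>u w\<close> lies above \<open>f v\<close>.\<close>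

lemma exists_upper_set:
  assumes "f \<in> edge_region R"
  obtains x where "x \<in> P" "upper_set (edge_interior R f) (supp x)"
proof -
  let ?h = "edge_interior R f"
  obtain u w v where uwv: "R u w" "f v < f u" "f v < f w"
    using assms unfolding edge_region_def by blast
  define M where "M = Max (range ?h)"
  have M: "?h x \<le> M" for x
    unfolding M_def by simp
  have "M \<in> range ?h"
    unfolding M_def by (intro Max_in) auto
  then have "{x. ?h x = M} \<noteq> {}"
    by auto
  moreover have "?h v < M"
    using uwv edge_interior_le[of f v] edge_interior_ge[of u w f] M[of u] by linarith
  then have "{x. ?h x = M} \<noteq> UNIV"
    by (metis (mono_tags) UNIV_I less_irrefl mem_Collect_eq)
  moreover have "\<exists>w\<in>{x. ?h x = M}. R u w" if "?h u = M" for u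
    using that M edge_interior_neighbour by (metis (mono_tags) antisym mem_Collect_eq)
  ultimately have "{x. ?h x = M} \<in> supp ` P"
    unfolding supp_image by simp
  then obtain x where "x \<in> P" "supp x = {x. ?h x = M}"
    by auto
  moreover have "upper_set ?h {x. ?h x = M}"
    unfolding upper_set_def using M by (auto simp: less_le)
  ultimately show ?thesis
    using that by auto
qed

lemma weights_sum_pos:
  assumes "f \<in> edge_region R"
  shows "0 < (\<Sum>y\<in>P. upper_weight (edge_interior R f) (supp y))"
proof -
  obtain x where "x \<in> P" "upper_set (edge_interior R f) (supp x)"
    using exists_upper_set assms by blast
  then show ?thesis
    using finite_P upper_weight_nonneg upper_weight_eq_0_iff by (intro sum_pos2[of P x]) (auto simp: less_le)
qed

lemma weights_nonzero_iff:
  assumes "f \<in> edge_region R"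
  shows "weights f x \<noteq> 0 \<longleftrightarrow> x \<in> P \<and> upper_set (edge_interior R f) (supp x)"
  using weights_sum_pos[OF assms] upper_weight_eq_0_iff unfolding weights_def by auto

lemma weights_nonneg: "0 \<le> weights f x"
  unfolding weights_def by (auto intro!: divide_nonneg_nonneg sum_nonneg upper_weight_nonneg)

lemma weights_sum: "f \<in> edge_region R \<Longrightarrow> (\<Sum>x\<in>P. weights f x) = 1"
  using weights_sum_pos[of f] by (simp add: weights_def flip: sum_divide_distrib)

lemma weights_points:
  assumes f: "f \<in> edge_region R"
  shows "weights f \<in> points"
  unfolding points_iff
proof (intro conjI allI impI ballI)
  show "supp x \<subseteq> supp y \<or> supp y \<subseteq> supp x"
    if "weights f x \<noteq> 0" "weights f y \<noteq> 0" for x y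
    using f that upper_sets_nested weights_nonzero_iff by blast
  show "weights f x = 0" if "x \<notin> P" for x
    using that by (simp add: weights_def)
qed (rule weights_nonneg weights_sum f)+

lemma continuous_on_weights: "continuous_on (edge_region R) weights"
proof (rule continuous_on_coordinatewise_then_product)
  have coord: "continuous_on (edge_region R) (\<lambda>f. f u)" for u :: 'v
    by (rule continuous_on_subset[OF continuous_on_product_coordinates]) auto
  have "continuous_on (edge_region R) (\<lambda>f. edge_interior R f u)" for u
    unfolding edge_interior_def using no_isolated[of u]
    by (intro continuous_on_Max_image continuous_on_min coord) auto
  then have "continuous_on (edge_region R) (\<lambda>f. upper_weight (edge_interior R f) U)" for U
    unfolding upper_weight_def case_prod_beta
    by (intro continuous_on_prod continuous_on_max continuous_intros)
  then show "continuous_on (edge_region R) (\<lambda>f. weights f x)" for x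
    using weights_sum_pos unfolding weights_def
    by (cases "x \<in> P") (auto intro!: continuous_on_divide continuous_on_sum simp: less_le)
qed

section \<open>From points of the order complex to functions\<close>

lemma continuous_on_height: "continuous_on S height"
proof (rule continuous_on_coordinatewise_then_product)
  have "continuous_on S (\<lambda>t. t x)" for x :: 'a
    by (rule continuous_on_subset[OF continuous_on_product_coordinates]) auto
  then show "continuous_on S (\<lambda>t. height t v)" for v
    unfolding height_def by (intro continuous_on_sum continuous_on_mult continuous_on_const)
qed

lemma height_comonotone:
  assumes t: "t \<in> points" and f: "\<And>x. x \<in> P \<Longrightarrow> t x \<noteq> 0 \<Longrightarrow> u \<in> supp x \<Longrightarrow> w \<in> supp x"
  shows "height t u \<le> height t w"
  unfolding height_def
proof (rule sum_mono)
  fix x assume "x \<in> P"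
  moreover have "0 \<le> t x"
    using t unfolding points_iff by blast
  ultimately show "t x * of_bool (u \<in> supp x) \<le> t x * of_bool (w \<in> supp x)"
    using f[of x] by (cases "t x = 0") auto
qed

text \<open>A chain member containing a vertex outside \<open>supp x\<close> is not a subset of
  \<open>supp x\<close>, so it contains all of \<open>supp x\<close>. The summand of
  \<open>x\<close> itself makes the inequality strict.\<close>

lemma height_upper_set:
  assumes t: "t \<in> points" and x: "t x \<noteq> 0"
  shows "x \<in> P \<and> upper_set (height t) (supp x)"
proof -
  have xP: "x \<in> P"
    using t x unfolding points_iff by auto
  have "height t v < height t u" if "u \<in> supp x" "v \<notin> supp x" for u v
    unfolding height_def
  proof (rule sum_strict_mono_ex1[OF finite_P])
    show "\<forall>y\<in>P. t y * of_bool (v \<in> supp y) \<le> t y * of_bool (u \<in> supp y)"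
    proof
      fix y assume y: "y \<in> P"
      show "t y * of_bool (v \<in> supp y) \<le> t y * of_bool (u \<in> supp y)"
      proof (cases "t y = 0")
        case False
        then have "supp x \<subseteq> supp y \<or> supp y \<subseteq> supp x" "0 \<le> t y"
          using t x xP y unfolding points_iff by auto
        then show ?thesis
          using that by (auto simp: of_bool_def)
      qed simp
    qed
    have "0 < t x"
      using t x unfolding points_iff by (simp add: less_le)
    then show "\<exists>y\<in>P. t y * of_bool (v \<in> supp y) < t y * of_bool (u \<in> supp y)"
      using that xP by (intro bexI[of _ x]) auto
  qed
  then show ?thesis
    using xP unfolding upper_set_def by auto
qed

lemma points_nonzero:
  assumes "t \<in> points"
  obtains x where "x \<in> P" "t x \<noteq> 0"
proof -
  have "\<exists>x\<in>P. t x \<noteq> 0"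
  proof (rule ccontr)
    assume "\<not> (\<exists>x\<in>P. t x \<noteq> 0)"
    then have "(\<Sum>x\<in>P. t x) = 0"
      by (intro sum.neutral) auto
    then show False
      using assms unfolding points_iff by simp
  qed
  then show ?thesis
    using that by blast
qed

text \<open>The smallest chain member containing \<open>u\<close> contains a neighbour of
  \<open>u\<close> and is included in every other member containing \<open>u\<close>. If no member
  contains \<open>u\<close>, its height is least and any neighbour will do.\<close>

lemma height_neighbour:
  assumes t: "t \<in> points"
  shows "\<exists>w. R u w \<and> height t u \<le> height t w"
proof (cases "\<exists>x\<in>P. t x \<noteq> 0 \<and> u \<in> supp x")
  case True
  define X where "X = {x\<in>P. t x \<noteq> 0 \<and> u \<in> supp x}"
  then obtain x where x: "x \<in> X" "\<And>y. y \<in> X \<Longrightarrow> card (supp x) \<le> card (supp y)"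
    using ex_has_least_nat[of "\<lambda>x. x \<in> X" _ "\<lambda>x. card (supp x)"] True by auto
  then obtain w where w: "w \<in> supp x" "R u w"
    using supp_P unfolding X_def by blast
  have "supp x \<subseteq> supp y" if "y \<in> X" for y
  proof -
    have "supp x \<subseteq> supp y \<or> supp y \<subseteq> supp x"
      using t x that unfolding points_iff X_def by auto
    then show ?thesis
      using x(2)[OF that] card_seteq[of "supp x" "supp y"] by auto
  qed
  then have "height t u \<le> height t w"
    using w by (intro height_comonotone[OF t]) (auto simp: X_def)
  then show ?thesis
    using w by blast
next
  case False
  then have "height t u \<le> height t w" for w
    by (intro height_comonotone[OF t]) auto
  then show ?thesis
    using no_isolated by blast
qed

lemma height_edge_region:
  assumes t: "t \<in> points"
  shows "height t \<in> edge_region R"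
proof -
  obtain x where x: "x \<in> P" "t x \<noteq> 0"
    using points_nonzero t by blast
  then have up: "upper_set (height t) (supp x)"
    using height_upper_set t by blast
  obtain u w v where "u \<in> supp x" "w \<in> supp x" "R u w" "v \<notin> supp x"
    using supp_P[OF x(1)] by blast
  then show ?thesis
    using up unfolding edge_region_def upper_set_def by blast
qed

text \<open>Upper sets of one common function are nested, so the union of the two supports is still
  a chain and the whole segment lies in one simplex.\<close>

lemma points_segment:
  assumes t: "t \<in> points" and s: "s \<in> points" and \<tau>: "0 \<le> \<tau>" "\<tau> \<le> (1::real)"
    and f: "\<And>x. t x \<noteq> 0 \<or> s x \<noteq> 0 \<Longrightarrow> upper_set f (supp x)"
  shows "(\<lambda>x. (1 - \<tau>) * t x + \<tau> * s x) \<in> points"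
  unfolding points_iff
proof (intro conjI allI impI ballI)
  show "0 \<le> (1 - \<tau>) * t x + \<tau> * s x" for x
    using t s \<tau> unfolding points_iff by simp
  show "(1 - \<tau>) * t x + \<tau> * s x = 0" if "x \<notin> P" for x
    using t s that unfolding points_iff by simp
  show "(\<Sum>x\<in>P. (1 - \<tau>) * t x + \<tau> * s x) = 1"
    using t s unfolding points_iff by (simp add: sum.distrib flip: sum_distrib_left)
  show "supp x \<subseteq> supp y \<or> supp y \<subseteq> supp x"
    if "(1 - \<tau>) * t x + \<tau> * s x \<noteq> 0" "(1 - \<tau>) * t y + \<tau> * s y \<noteq> 0" for x y
  proof (rule upper_sets_nested)
    show "upper_set f (supp x)" "upper_set f (supp y)"
      using that by (auto intro!: f)
  qed
qed

text \<open>Take \<open>v\<close> minimal for \<open>f\<close> and an edge \<open>u w\<close> on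
  which the edge interior is maximal. Every set of nonzero weight contains \<open>u\<close> and
  \<open>w\<close> and omits \<open>v\<close>, so the new height is \<open>1\<close> at
  \<open>u\<close> and \<open>w\<close> and \<open>0\<close> at \<open>v\<close>. The edge therefore
  stays above \<open>v\<close> along the segment.\<close>

lemma edge_region_segment:
  assumes f: "f \<in> edge_region R" and \<tau>: "0 \<le> \<tau>" "\<tau> \<le> 1"
  shows "(\<lambda>v. (1 - \<tau>) * f v + \<tau> * height (weights f) v) \<in> edge_region R"
proof -
  let ?h = "edge_interior R f"
  obtain x where x: "x \<in> P" "upper_set ?h (supp x)"
    using exists_upper_set f by blast
  have "Min (range f) \<in> range f" "Max (range ?h) \<in> range ?h"
    by (intro Min_in Max_in; simp)+
  then obtain v u where "f v = Min (range f)" "?h u = Max (range ?h)"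
    by (metis imageE)
  then have v: "f v \<le> f v'" and u: "?h v' \<le> ?h u" for v'
    by simp_all
  obtain w where w: "R u w" "?h u \<le> ?h w"
    using edge_interior_neighbour by blast
  have hv: "?h v \<le> ?h v'" for v'
  proof -
    obtain w where "?h v' = min (f v') (f w)"
      using edge_interior_attained by blast
    then show ?thesis
      using edge_interior_le[of f v] v[of v'] v[of w] by linarith
  qed
  obtain u' v' where "?h v' < ?h u'"
    using x supp_P[OF x(1)] unfolding upper_set_def by blast
  then have "?h v < ?h u"
    using hv[of v'] u[of u'] by linarith
  moreover obtain w' where "?h v = min (f v) (f w')"
    using edge_interior_attained by blast
  then have "?h v = f v"
    using v[of w'] by linarith
  ultimately have fuw: "f v < f u" "f v < f w"
    using edge_interior_le[of f u] edge_interior_le[of f w] w by linarith+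
  have top: "a \<in> supp y" if "y \<in> P" "weights f y \<noteq> 0" "\<And>v'. ?h v' \<le> ?h a" for a y
  proof (rule ccontr)
    assume "a \<notin> supp y"
    moreover obtain b where "b \<in> supp y"
      using supp_P[OF \<open>y \<in> P\<close>] by blast
    ultimately have "?h a < ?h b"
      using that(2) weights_nonzero_iff[OF f] unfolding upper_set_def by auto
    then show False
      using that(3)[of b] by simp
  qed
  have bot: "v \<notin> supp y" if "y \<in> P" "weights f y \<noteq> 0" for y
  proof
    assume "v \<in> supp y"
    moreover obtain b where "b \<notin> supp y"
      using supp_P[OF \<open>y \<in> P\<close>] by blast
    ultimately have "?h b < ?h v"
      using that(2) weights_nonzero_iff[OF f] unfolding upper_set_def by auto
    then show False
      using hv[of b] by simp
  qed
  have 1: "height (weights f) a = 1" if "\<And>v'. ?h v' \<le> ?h a" for a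
  proof -
    have "height (weights f) a = (\<Sum>y\<in>P. weights f y)"
      unfolding height_def using top[OF _ _ that] by (intro sum.cong) auto
    then show ?thesis
      using weights_sum f by simp
  qed
  have "height (weights f) v = 0"
    unfolding height_def using bot by (intro sum.neutral) auto
  moreover have "height (weights f) u = 1" "height (weights f) w = 1"
    using 1[OF u] 1[of w] u w(2) order_trans by blast+
  moreover have "(1 - \<tau>) * f v < (1 - \<tau>) * f a + \<tau>" if "f v < f a" for a
  proof (cases "\<tau> = 1")
    case False
    then have "(1 - \<tau>) * f v < (1 - \<tau>) * f a"
      using that \<tau> by simp
    then show ?thesis
      using \<tau> by linarith
  qed simp
  ultimately show ?thesis
    using w fuw unfolding edge_region_def mem_Collect_eq
    by (intro exI[of _ u] exI[of _ w] exI[of _ v] conjI) simp_all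
qed

lemma realization_homotopy_equivalent:
  "realization (order_complex r P) homotopy_equivalent_space top_of_set (edge_region R)"
proof -
  have "top_of_set points homotopy_equivalent_space top_of_set (edge_region R)"
  proof (rule homotopy_equivalent_by_linear)
    show "continuous_on points height" "continuous_on (edge_region R) weights"
      by (rule continuous_on_height continuous_on_weights)+
    show "height ` points \<subseteq> edge_region R" "weights ` edge_region R \<subseteq> points"
      using height_edge_region weights_points by blast+
    show "(\<lambda>x. (1 - \<tau>) * t x + \<tau> * weights (height t) x) \<in> points"
      if t: "t \<in> points" and \<tau>: "0 \<le> \<tau>" "\<tau> \<le> 1" for t \<tau>
    proof (rule points_segment[OF t weights_points \<tau>, where f = "height t"])
      \<comment> \<open>Thus both \<open>t\<close> and \<open>weights (height t)\<close> are
        supported on upper sets of the same function.\<close>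
      have "edge_interior R (height t) = height t"
        using edge_interior_eq height_neighbour t by blast
      then show "upper_set (height t) (supp x)" if "t x \<noteq> 0 \<or> weights (height t) x \<noteq> 0" for x
        using that height_upper_set[OF t] weights_nonzero_iff[OF height_edge_region[OF t]] by metis
    qed (rule height_edge_region[OF t])
    show "(\<lambda>v. (1 - \<tau>) * f v + \<tau> * height (weights f) v) \<in> edge_region R"
      if "f \<in> edge_region R" "0 \<le> \<tau>" "\<tau> \<le> 1" for f \<tau>
      using edge_region_segment that .
  qed
  then show ?thesis
    unfolding realization_def by (simp only: euclidean_product_topology)
qed

end


section \<open>The complement of the cone over a cycle\<close>

text \<open>Functions on the vertices \<open>0, \<dots>, d + 1\<close> of the cycle are taken modulo constants, normalised to
  vanish at the vertex \<open>d + 1\<close>; so this vertex is represented by \<open>-1\<close> on \<open>{0..d}\<close>. The complement of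
  the region below is then the cone over the cycle. The linear map \<open>(moment, mass)\<close> sends the vertex
  \<open>i \<le> d\<close> to \<open>(i, 1)\<close> and the vertex \<open>d + 1\<close> to \<open>-(d + 1) (d / 2, 1)\<close>, and these vectors wind
  once around the origin.\<close>

definition cycle_region :: "nat \<Rightarrow> (nat \<Rightarrow> real) set"
  where "cycle_region d = {g. (\<forall>i>d. g i = 0) \<and>
    (\<exists>u w v. u < w \<and> w \<le> Suc d \<and> v \<le> Suc d \<and> w \<noteq> Suc u \<and> \<not> (u = 0 \<and> w = Suc d) \<and> g v < g u \<and> g v < g w)}"

definition mass :: "nat \<Rightarrow> (nat \<Rightarrow> real) \<Rightarrow> real"
  where "mass d g = (\<Sum>i\<le>d. g i)"

definition moment :: "nat \<Rightarrow> (nat \<Rightarrow> real) \<Rightarrow> real"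
  where "moment d g = (\<Sum>i\<le>d. real i * g i)"

text \<open>Up to the factor \<open>2 / (d + 1)\<close>, \<open>apex_part d x m\<close> is the least multiple of the image of the vertex
  \<open>d + 1\<close> to be subtracted from \<open>(x, m)\<close> in order to reach the cone
  spanned by the images of the other vertices, where the inverse of \<open>(moment, mass)\<close> is given by hat functions.\<close>

definition apex_part :: "nat \<Rightarrow> real \<Rightarrow> real \<Rightarrow> real"
  where "apex_part d x m = max 0 (max (- x / d) ((x - d * m) / d))"

text \<open>Removing the apex contribution leaves \<open>(x + t * d, m + 2 * t)\<close>. The hat
  function distributes this over two consecutive vertices, and \<open>2 * t / (d + 1)\<close> is the
  coefficient of the apex vector, which is \<open>-1\<close> on \<open>{0..d}\<close>.\<close>

definition cycle_section :: "nat \<Rightarrow> real \<Rightarrow> real \<Rightarrow> nat \<Rightarrow> real"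
  where "cycle_section d x m i = (let t = apex_part d x m in
    if i \<le> d then max 0 (m + 2 * t - \<bar>x + t * d - i * (m + 2 * t)\<bar>) - 2 * t / (d + 1) else 0)"

text \<open>For \<open>d \<ge> 2\<close> this is the point of the cone with the same moment and mass
  as \<open>g\<close>, that is, the projection to the cone along the common kernel.\<close>

definition fan :: "nat \<Rightarrow> (nat \<Rightarrow> real) \<Rightarrow> nat \<Rightarrow> real"
  where "fan d g = cycle_section d (moment d g) (mass d g)"

text \<open>For \<open>k < d\<close> and nonnegative \<open>a\<close>, \<open>b\<close> these
  vectors form the cone over the cycle edge from \<open>k\<close> to \<open>k + 1\<close>.\<close>

definition path_vec :: "nat \<Rightarrow> real \<Rightarrow> real \<Rightarrow> nat \<Rightarrow> real"
  where "path_vec k a b i = (if i = k then a else 0) + (if i = Suc k then b else 0)"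

text \<open>For \<open>j = 0\<close> or \<open>j = d\<close> and nonnegative \<open>a\<close>,
  \<open>b\<close> these vectors form the cone over the cycle edge from \<open>j\<close> to
  \<open>d + 1\<close>.\<close>

definition apex_vec :: "nat \<Rightarrow> nat \<Rightarrow> real \<Rightarrow> real \<Rightarrow> nat \<Rightarrow> real"
  where "apex_vec d j a b i = (if i \<le> d then (if i = j then a else 0) - b else 0)"

section \<open>Recovering points of the edge cones from moment and mass\<close>

lemma mass_path_vec: "k < d \<Longrightarrow> mass d (path_vec k a b) = a + b"
  by (simp add: mass_def path_vec_def sum.distrib)

lemma moment_path_vec: "k < d \<Longrightarrow> moment d (path_vec k a b) = k * a + (k + 1) * b"
  by (simp add: moment_def path_vec_def sum.distrib distrib_left if_distrib[of "\<lambda>x. _ * x"] cong: if_cong)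

lemma mass_apex_vec: "j \<le> d \<Longrightarrow> mass d (apex_vec d j a b) = a - (d + 1) * b"
  by (simp add: mass_def apex_vec_def sum_subtractf)

lemma moment_apex_vec: "j \<le> d \<Longrightarrow> moment d (apex_vec d j a b) = j * a - d * (d + 1) / 2 * b"
proof -
  assume "j \<le> d"
  have "(\<Sum>i\<le>d. real i) = d * (d + 1) / 2"
    by (induction d) (auto simp: field_simps)
  then show ?thesis
    using \<open>j \<le> d\<close> by (simp add: moment_def apex_vec_def right_diff_distrib sum_subtractf
        if_distrib[of "\<lambda>x. _ * x"] cong: if_cong flip: sum_distrib_right) (simp add: algebra_simps)
qed

text \<open>The moment lies between \<open>0\<close> and \<open>d\<close> times the mass, so the
  apex part vanishes. The hat function is centred between \<open>k\<close> and \<open>k + 1\<close>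
  and is zero at all other vertices.\<close>

lemma fan_path_vec:
  assumes k: "k < d" and ab: "0 \<le> a" "0 \<le> b"
  shows "fan d (path_vec k a b) = path_vec k a b"
proof
  fix i
  define x where "x = k * a + (k + 1) * b"
  define m where "m = a + b"
  have "real k \<le> d" "real (k + 1) \<le> d"
    using k by linarith+
  then have "0 \<le> x" "x \<le> d * m"
    unfolding x_def m_def using ab by (auto simp: distrib_left intro!: add_mono mult_right_mono)
  then have t: "apex_part d x m = 0"
    unfolding apex_part_def using k by (simp add: divide_simps)
  have x: "x - i * m = (real k - real i) * m + b"
    unfolding x_def m_def by (simp add: algebra_simps)
  consider "i < k" | "i = k" | "i = Suc k" | "Suc k < i"
    by linarith
  then have "cycle_section d x m i = path_vec k a b i"
  proof cases
    case 1
    then have "1 * m \<le> (real k - real i) * m"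
      using ab by (intro mult_right_mono) (auto simp: m_def)
    then show ?thesis
      using 1 ab k unfolding cycle_section_def t by (simp add: x path_vec_def)
  next
    case 2
    then have "x - i * m = b"
      using x by simp
    then show ?thesis
      using 2 ab k unfolding cycle_section_def t by (simp add: path_vec_def m_def)
  next
    case 3
    then have "x - i * m = b - m"
      using x by (simp add: algebra_simps)
    then show ?thesis
      using 3 ab k unfolding cycle_section_def t by (simp add: path_vec_def m_def)
  next
    case 4
    then have "(real k - real i) * m \<le> (-2) * m"
      using ab by (intro mult_right_mono) (auto simp: m_def)
    moreover have "b \<le> m"
      using ab by (simp add: m_def)
    ultimately show ?thesis
      using 4 ab k unfolding cycle_section_def t by (simp add: x path_vec_def)
  qed
  moreover have "moment d (path_vec k a b) = x" "mass d (path_vec k a b) = m"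
    unfolding moment_path_vec[OF k] mass_path_vec[OF k] x_def m_def by (simp_all add: algebra_simps)
  ultimately show "fan d (path_vec k a b) i = path_vec k a b i"
    unfolding fan_def by simp
qed

text \<open>The apex part is \<open>t = b * (d + 1) / 2\<close>. Of the two quotients in its
  definition one equals \<open>t\<close> and the other \<open>t - a\<close>, with roles exchanged
  between \<open>j = 0\<close> and \<open>j = d\<close>. What remains is \<open>a\<close> times the
  vertex \<open>j\<close>, where the hat function is concentrated.\<close>

lemma fan_apex_vec:
  assumes d: "0 < d" and j: "j = 0 \<or> j = d" and ab: "0 \<le> a" "0 \<le> b"
  shows "fan d (apex_vec d j a b) = apex_vec d j a b"
proof
  fix i
  define t where "t = b * (d + 1) / 2"
  define x where "x = j * a - d * (d + 1) / 2 * b"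
  define m where "m = a - (d + 1) * b"
  have t0: "0 \<le> t"
    unfolding t_def using ab by simp
  have x: "x = j * a - d * t" and m: "m = a - 2 * t"
    unfolding x_def m_def t_def by (simp_all add: algebra_simps)
  have t: "apex_part d x m = t"
    using j
  proof
    assume "j = 0"
    then have "- x / d = t" "(x - d * m) / d = t - a"
      unfolding x m using d by (simp_all add: field_simps)
    then show ?thesis
      unfolding apex_part_def using t0 ab by simp
  next
    assume "j = d"
    then have "- x / d = t - a" "(x - d * m) / d = t"
      unfolding x m using d by (simp_all add: field_simps)
    then show ?thesis
      unfolding apex_part_def using t0 ab by simp
  qed
  have b: "2 * t / (real d + 1) = b"
    unfolding t_def by (simp add: field_simps)
  have xj: "x + t * d - i * a = (real j - real i) * a"
    unfolding x m by (simp add: algebra_simps)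
  have m2: "m + 2 * t = a"
    unfolding m by simp
  have "max 0 (a - \<bar>(real j - real i) * a\<bar>) = (if i = j then a else 0)"
  proof (cases "i = j")
    case False
    then have "1 * a \<le> \<bar>real j - real i\<bar> * a"
      using ab by (intro mult_right_mono) auto
    then show ?thesis
      using False ab by (simp add: abs_mult)
  qed (use ab in simp)
  then have "cycle_section d x m i = apex_vec d j a b i"
    unfolding cycle_section_def t Let_def m2 xj apex_vec_def by (simp add: b)
  moreover have "j \<le> d"
    using j by auto
  then have "moment d (apex_vec d j a b) = x" "mass d (apex_vec d j a b) = m"
    unfolding moment_apex_vec[OF \<open>j \<le> d\<close>] mass_apex_vec[OF \<open>j \<le> d\<close>] x_def m_def
    by (simp_all add: algebra_simps)
  ultimately show "fan d (apex_vec d j a b) i = apex_vec d j a b i"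
    unfolding fan_def by simp
qed

section \<open>The cone over the cycle as the union of its edge cones\<close>

lemma path_vec_not_in_cycle_region:
  assumes "0 \<le> a" "0 \<le> b"
  shows "path_vec k a b \<notin> cycle_region d"
  using assms unfolding cycle_region_def path_vec_def by (auto split: if_splits)

lemma apex_vec_not_in_cycle_region:
  assumes "j = 0 \<or> j = d" "0 \<le> a" "0 \<le> b"
  shows "apex_vec d j a b \<notin> cycle_region d"
proof
  assume "apex_vec d j a b \<in> cycle_region d"
  then obtain u w v where uw: "u < w" "w \<le> Suc d" "w \<noteq> Suc u" "\<not> (u = 0 \<and> w = Suc d)"
    and v: "apex_vec d j a b v < apex_vec d j a b u" "apex_vec d j a b v < apex_vec d j a b w"
    unfolding cycle_region_def by blast
  have "- b \<le> apex_vec d j a b v"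
    using assms unfolding apex_vec_def by auto
  then have "- b < apex_vec d j a b u" "- b < apex_vec d j a b w"
    using v by linarith+
  then have "u = j \<or> d < u" "w = j \<or> d < w"
    unfolding apex_vec_def by (auto split: if_splits)
  then show False
    using uw assms(1) by auto
qed

text \<open>A cycle of length \<open>d + 2 \<ge> 4\<close> has no triangle. The argument inspects
  the least element of \<open>S\<close>, whose only possible larger neighbours are its successor
  and, for \<open>0\<close>, the vertex \<open>d + 1\<close>.\<close>

lemma clique_in_cycle:
  assumes d: "2 \<le> d" and S: "S \<subseteq> {..Suc d}"
    and adj: "\<And>u w. u \<in> S \<Longrightarrow> w \<in> S \<Longrightarrow> u < w \<Longrightarrow> w = Suc u \<or> u = 0 \<and> w = Suc d"
  shows "S \<subseteq> {0, Suc d} \<or> (\<exists>k\<le>d. S \<subseteq> {k, Suc k})"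
proof (cases "S = {}")
  case False
  define u where "u = (LEAST u. u \<in> S)"
  have u: "u \<in> S" "\<And>w. w \<in> S \<Longrightarrow> u \<le> w"
    unfolding u_def using False by (auto intro: LeastI Least_le)
  show ?thesis
  proof (cases "Suc u \<in> S")
    case True
    have "w \<in> {u, Suc u}" if "w \<in> S" for w
      using adj[OF u(1) that] adj[OF True that] u(2)[OF that] d by force
    moreover have "u \<le> d"
      using True S by auto
    ultimately show ?thesis
      by blast
  next
    case False
    have "w = u \<or> u = 0 \<and> w = Suc d" if "w \<in> S" for w
      using adj[OF u(1) that] u(2)[OF that] that False by force
    then have "S \<subseteq> {0, Suc d} \<or> S \<subseteq> {u}"
      by (cases "u = 0") auto
    moreover have "u \<le> Suc d"
      using u(1) S by auto
    ultimately show ?thesis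
      by (cases "u = Suc d") (auto intro: exI[of _ u])
  qed
qed auto

text \<open>The set \<open>S\<close> above the minimum is a clique and so lies in an edge. On an
  edge avoiding \<open>d + 1\<close> the minimum is \<open>g (Suc d) = 0\<close>; on an edge at
  \<open>d + 1\<close> it is \<open>- b\<close>. The edge from \<open>d\<close> to
  \<open>d + 1\<close> belongs to the second case.\<close>

lemma not_in_cycle_region_cases:
  assumes d: "2 \<le> d" and g0: "\<And>i. d < i \<Longrightarrow> g i = 0" and g: "g \<notin> cycle_region d"
  obtains k a b where "k < d" "0 \<le> a" "0 \<le> b" "g = path_vec k a b"
  | j a b where "j = 0 \<or> j = d" "0 \<le> a" "0 \<le> b" "g = apex_vec d j a b"
proof -
  note path = that(1) and apex = that(2)
  have "Min (g ` {..Suc d}) \<in> g ` {..Suc d}"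
    by (intro Min_in) auto
  then obtain v where "v \<le> Suc d" "g v = Min (g ` {..Suc d})"
    by (metis atMost_iff imageE)
  then have v: "v \<le> Suc d" "\<And>i. i \<le> Suc d \<Longrightarrow> g v \<le> g i"
    by simp_all
  have v0: "g v \<le> 0"
    using v(2)[of "Suc d"] g0[of "Suc d"] by simp
  define S where "S = {u. u \<le> Suc d \<and> g v < g u}"
  have gv: "g i = g v" if "i \<notin> S" "i \<le> Suc d" for i
    using that v(2)[of i] unfolding S_def by auto
  have "S \<subseteq> {0, Suc d} \<or> (\<exists>k\<le>d. S \<subseteq> {k, Suc k})"
  proof (rule clique_in_cycle[OF d])
    show "S \<subseteq> {..Suc d}"
      unfolding S_def by auto
    show "w = Suc u \<or> u = 0 \<and> w = Suc d" if "u \<in> S" "w \<in> S" "u < w" for u w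
      using g g0 v(1) that unfolding cycle_region_def S_def by blast
  qed
  moreover have ?thesis if j: "j = 0 \<or> j = d" and S: "S \<subseteq> {j, Suc d}" for j
  proof -
    have "i \<notin> S" if "i \<noteq> j" "i \<le> d" for i
      using S that by auto
    then have "g i = apex_vec d j (g j - g v) (- g v) i" for i
      using g0[of i] gv[of i] unfolding apex_vec_def by (auto simp: not_le)
    then have "g = apex_vec d j (g j - g v) (- g v)"
      by blast
    moreover have "0 \<le> g j - g v" "0 \<le> - g v"
      using v(2)[of j] v0 j by auto
    ultimately show ?thesis
      by (intro apex[OF j])
  qed
  moreover have ?thesis if k: "k < d" and S: "S \<subseteq> {k, Suc k}" for k
  proof -
    have "Suc d \<notin> S"
      using S k by auto
    then have "g v = 0"
      using gv[of "Suc d"] g0[of "Suc d"] by simp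
    then have "g i = path_vec k (g k) (g (Suc k)) i" for i
      using g0[of i] gv[of i] S unfolding path_vec_def by (cases "i \<le> d") auto
    then have "g = path_vec k (g k) (g (Suc k))"
      by blast
    moreover have "0 \<le> g k" "0 \<le> g (Suc k)"
      using v(2)[of k] v(2)[of "Suc k"] \<open>g v = 0\<close> k by auto
    ultimately show ?thesis
      by (intro path[OF k])
  qed
  ultimately show ?thesis
    by (metis le_neq_implies_less)
qed

section \<open>Bijectivity of \<open>(moment, mass)\<close> on the cone\<close>

lemma fan_eq_self:
  assumes "2 \<le> d" "\<And>i. d < i \<Longrightarrow> g i = 0" "g \<notin> cycle_region d"
  shows "fan d g = g"
  by (rule not_in_cycle_region_cases[OF assms])
    (use assms(1) fan_path_vec fan_apex_vec[of d] in auto)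

text \<open>Choosing the least \<open>k\<close> with \<open>x \<le> (k + 1) * m\<close> avoids a
  division by \<open>m\<close>, which may be zero.\<close>

lemma path_between_multiples:
  fixes x m :: real and d :: nat
  assumes d: "0 < d" and x: "0 \<le> x" "x \<le> d * m"
  obtains k where "k < d" "k * m \<le> x" "x \<le> (real k + 1) * m"
proof -
  define Q where "Q = (\<lambda>k::nat. x \<le> (real k + 1) * m)"
  have "Q (d - 1)"
    unfolding Q_def using x d by (simp add: of_nat_diff)
  then obtain k where k: "k \<le> d - 1" "Q k" "\<And>l. l < k \<Longrightarrow> \<not> Q l"
    using ex_least_nat_le by blast
  have "k * m \<le> x"
  proof (cases k)
    case (Suc l)
    then have "real k = real l + 1" "\<not> Q l"
      using k(3) by simp_all
    then show ?thesis
      unfolding Q_def by simp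
  qed (use x in simp)
  moreover have "x \<le> (real k + 1) * m"
    using k(2) unfolding Q_def .
  moreover have "k < d"
    using k(1) d by linarith
  ultimately show ?thesis
    using that by blast
qed

text \<open>The term attaining the maximum in \<open>apex_part\<close> selects the edge: a path edge
  for \<open>0\<close>, the edge from \<open>0\<close> to the apex for \<open>- x / d\<close>, and
  the edge from \<open>d\<close> to the apex for the last term.\<close>

lemma exists_fan_point:
  assumes d: "2 \<le> d"
  shows "\<exists>g. g \<notin> cycle_region d \<and> (\<forall>i>d. g i = 0) \<and> moment d g = x \<and> mass d g = m"
proof -
  define t where "t = apex_part d x m"
  have d0: "0 < d"
    using d by simp
  have apex: ?thesis if j: "j = 0 \<or> j = d" and a: "0 \<le> m + 2 * t" and x: "x = j * (m + 2 * t) - d * t" for j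
  proof -
    define b where "b = 2 * t / (real d + 1)"
    have b: "(real d + 1) * b = 2 * t"
      unfolding b_def by (simp add: field_simps)
    have db: "real d * (real d + 1) / 2 * b = d * t"
      using arg_cong[OF b, of "\<lambda>z. d / 2 * z"] by (simp add: algebra_simps)
    let ?g = "apex_vec d j (m + 2 * t) b"
    have "0 \<le> b"
      unfolding b_def t_def apex_part_def by simp
    then have "?g \<notin> cycle_region d"
      using apex_vec_not_in_cycle_region[OF j a] by simp
    moreover have "j \<le> d"
      using j by auto
    then have "moment d ?g = x" "mass d ?g = m"
      unfolding moment_apex_vec[OF \<open>j \<le> d\<close>] mass_apex_vec[OF \<open>j \<le> d\<close>] using x b db by (simp_all add: add.commute)
    ultimately show ?thesis
      by (intro exI[of _ ?g]) (simp add: apex_vec_def)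
  qed
  have t: "0 \<le> t" "- x / d \<le> t" "(x - d * m) / d \<le> t"
    unfolding t_def apex_part_def by simp_all
  have t': "- x \<le> d * t" "x - d * m \<le> d * t"
    using t d0 by (simp_all add: divide_simps mult.commute)
  have "max 0 (max p q) \<in> {0, p, q}" for p q :: real
    by (auto simp: max_def)
  then consider "t = 0" | "t = - x / d" | "t = (x - d * m) / d"
    unfolding t_def apex_part_def by blast
  then show ?thesis
  proof cases
    case 1
    then obtain k where k: "k < d" "k * m \<le> x" "x \<le> (real k + 1) * m"
      using t' path_between_multiples[OF d0, of x m] by auto
    \<comment> \<open>The coefficients express \<open>(x, m)\<close> in the basis
      \<open>(k, 1)\<close>, \<open>(k + 1, 1)\<close>.\<close>
    let ?g = "path_vec k ((real k + 1) * m - x) (x - k * m)"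
    have "?g \<notin> cycle_region d"
      using k by (intro path_vec_not_in_cycle_region) auto
    moreover have "moment d ?g = x" "mass d ?g = m"
      unfolding moment_path_vec[OF k(1)] mass_path_vec[OF k(1)] by (simp_all add: algebra_simps)
    ultimately show ?thesis
      using k(1) by (intro exI[of _ ?g]) (simp add: path_vec_def)
  next
    case 2
    then have x: "x = - d * t"
      using d0 by simp
    then have "0 \<le> d * (m + 2 * t)"
      using t' by (simp add: algebra_simps)
    then show ?thesis
      using d0 x by (intro apex[of 0]) (auto simp: zero_le_mult_iff)
  next
    case 3
    then have x: "x = d * t + d * m"
      using d0 by (simp add: field_simps)
    then have "0 \<le> d * (m + 2 * t)"
      using t' by (simp add: algebra_simps)
    then have "0 \<le> m + 2 * t"
      using d0 by (simp add: zero_le_mult_iff)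
    then show ?thesis
      using x by (intro apex[of d]) (auto simp: algebra_simps)
  qed
qed

text \<open>\<open>fan d g\<close> depends only on the moment and mass of \<open>g\<close>, so it
  agrees with \<open>fan d h\<close> for a cone point \<open>h\<close> having the same ones, and
  \<open>fan\<close> fixes \<open>h\<close>. This replaces a computation with the formula for
  \<open>cycle_section\<close>.\<close>

lemma fan_properties:
  assumes d: "2 \<le> d"
  shows "fan d g \<notin> cycle_region d" "d < i \<Longrightarrow> fan d g i = 0"
    "moment d (fan d g) = moment d g" "mass d (fan d g) = mass d g"
proof -
  obtain h where h: "h \<notin> cycle_region d" "\<forall>i>d. h i = 0" "moment d h = moment d g" "mass d h = mass d g"
    using exists_fan_point[OF d] by blast
  moreover have "fan d g = fan d h"
    unfolding fan_def h by simp
  then have "fan d g = h"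
    using h fan_eq_self[OF d, of h] by simp
  ultimately show "fan d g \<notin> cycle_region d" "d < i \<Longrightarrow> fan d g i = 0"
    "moment d (fan d g) = moment d g" "mass d (fan d g) = mass d g"
    by simp_all
qed

section \<open>Scaling, and moving off the cone along the kernel\<close>

lemma cycle_region_scale:
  assumes "0 < c" "(\<lambda>i. c * g i) \<in> cycle_region d"
  shows "g \<in> cycle_region d"
  using assms unfolding cycle_region_def by simp

lemma zero_not_in_cycle_region: "(\<lambda>_. 0) \<notin> cycle_region d"
  unfolding cycle_region_def by simp

lemma moment_linear: "moment d (\<lambda>i. a * f i + b * g i) = a * moment d f + b * moment d g"
  unfolding moment_def by (simp add: sum_distrib_left sum.distrib algebra_simps)

lemma mass_linear: "mass d (\<lambda>i. a * f i + b * g i) = a * mass d f + b * mass d g"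
  unfolding mass_def by (simp add: sum_distrib_left sum.distrib)

lemma fan_null:
  assumes "2 \<le> d" "moment d g = 0" "mass d g = 0"
  shows "fan d g = (\<lambda>_. 0)"
  using fan_eq_self[OF assms(1), of "\<lambda>_. 0"] zero_not_in_cycle_region assms(2,3)
  unfolding fan_def by (simp add: moment_def mass_def)

text \<open>The cone is closed under scaling by \<open>c \<ge> 0\<close>, so \<open>c\<close> times
  \<open>fan d g\<close> is a cone point with the moment and mass of \<open>h\<close>, hence equal
  to \<open>fan d h\<close>.\<close>

lemma fan_scale:
  assumes d: "2 \<le> d" and c: "0 \<le> c" and "moment d h = c * moment d g" "mass d h = c * mass d g"
  shows "fan d h = (\<lambda>i. c * fan d g i)"
proof -
  have "moment d (\<lambda>i. c * fan d g i) = moment d h" "mass d (\<lambda>i. c * fan d g i) = mass d h"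
    using moment_linear[of d c "fan d g" 0 "\<lambda>_. 0"] mass_linear[of d c "fan d g" 0 "\<lambda>_. 0"]
      fan_properties(3,4)[OF d, of g] assms by simp_all
  then have "fan d h = fan d (\<lambda>i. c * fan d g i)"
    unfolding fan_def by simp
  moreover have "(\<lambda>i. c * fan d g i) \<notin> cycle_region d"
    using c cycle_region_scale[of c "fan d g" d] fan_properties(1)[OF d] zero_not_in_cycle_region
    by (cases "c = 0") auto
  ultimately show ?thesis
    using fan_eq_self[OF d] fan_properties(2)[OF d] by simp
qed

text \<open>Since \<open>g - fan d g\<close> has zero moment and mass, those of \<open>?h\<close>
  are \<open>1 - \<tau>\<close> times those of \<open>g\<close>. If \<open>?h\<close> were in the
  cone, it would equal \<open>1 - \<tau>\<close> times \<open>fan d g\<close>. Comparing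
  coefficients then gives \<open>C * g = C * fan d g\<close> with \<open>C > 0\<close>, which puts
  \<open>g\<close> itself in the cone.\<close>

lemma fan_homotopy:
  assumes d: "2 \<le> d" and g: "g \<in> cycle_region d" and c: "0 < c" and \<tau>: "0 \<le> \<tau>" "\<tau> \<le> 1"
  shows "(\<lambda>i. (1 - \<tau>) * g i + \<tau> * (c * (g i - fan d g i))) \<in> cycle_region d" (is "?h \<in> _")
proof (rule ccontr)
  assume h: "?h \<notin> cycle_region d"
  define C where "C = (1 - \<tau>) + \<tau> * c"
  have C: "0 < C"
    unfolding C_def using \<tau> c by (cases "\<tau> = 1") (auto intro: add_pos_nonneg)
  have h_eq: "?h = (\<lambda>i. C * g i + (- \<tau> * c) * fan d g i)"
    unfolding C_def by (auto simp: algebra_simps)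
  have "?h i = 0" if "d < i" for i
    using g that fan_properties(2)[OF d] unfolding cycle_region_def by simp
  then have "fan d ?h = ?h"
    using fan_eq_self[OF d _ h] by blast
  moreover have "fan d ?h = (\<lambda>i. (1 - \<tau>) * fan d g i)"
  proof (rule fan_scale[OF d])
    show "moment d ?h = (1 - \<tau>) * moment d g" "mass d ?h = (1 - \<tau>) * mass d g"
      unfolding h_eq moment_linear mass_linear fan_properties(3,4)[OF d] C_def
      by (simp_all add: algebra_simps)
  qed (use \<tau> in simp)
  ultimately have "(\<lambda>i. C * g i + (- \<tau> * c) * fan d g i) = (\<lambda>i. (1 - \<tau>) * fan d g i)"
    unfolding h_eq by simp
  then have "C * g i + (- \<tau> * c) * fan d g i = (1 - \<tau>) * fan d g i" for i
    by (rule fun_cong)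
  then have "C * g i = C * fan d g i" for i
    unfolding C_def by (simp add: algebra_simps)
  then have "g = fan d g"
    using C by auto
  then show False
    using g fan_properties(1)[OF d] by metis
qed

lemma continuous_on_fan: "continuous_on S (\<lambda>g. fan d g i)"
proof -
  have coord: "continuous_on S (\<lambda>g. g i)" for i :: nat
    by (rule continuous_on_subset[OF continuous_on_product_coordinates]) auto
  have "continuous_on S (moment d)" "continuous_on S (mass d)"
    unfolding moment_def mass_def by (intro continuous_intros coord)+
  then show ?thesis
    unfolding fan_def cycle_section_def apex_part_def Let_def divide_inverse
    by (cases "i \<le> d") (auto intro!: continuous_intros)
qed

text \<open>Parametrises the common kernel of \<open>moment\<close> and \<open>mass\<close> by the coordinates from \<open>2\<close> on.\<close>

definition sphere_embed :: "nat \<Rightarrow> (nat \<Rightarrow> real) \<Rightarrow> nat \<Rightarrow> real"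
  where "sphere_embed e y i = (if i = 0 then \<Sum>j\<le>e. (real j + 1) * y j
    else if i = 1 then - (\<Sum>j\<le>e. (real j + 2) * y j) else y (i - 2))"

lemma sum_atMost_Suc_Suc: "(\<Sum>i\<le>Suc (Suc e). f i) = f 0 + f 1 + (\<Sum>i\<le>e. f (i + 2))"
  for f :: "nat \<Rightarrow> real"
  by (simp only: sum.atMost_Suc_shift) simp

lemma moment_sphere_embed: "moment (e + 2) (sphere_embed e y) = 0"
  unfolding moment_def add_2_eq_Suc' sum_atMost_Suc_Suc by (simp add: sphere_embed_def add.commute)

lemma mass_sphere_embed: "mass (e + 2) (sphere_embed e y) = 0"
  unfolding mass_def add_2_eq_Suc' sum_atMost_Suc_Suc
  by (simp add: sphere_embed_def algebra_simps sum.distrib) (simp add: sum_distrib_left mult.commute)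

lemma sphere_embed_tail:
  assumes "moment (e + 2) g = 0" "mass (e + 2) g = 0"
  shows "sphere_embed e (\<lambda>i. g (i + 2)) = g"
proof
  fix i
  have 1: "g 1 = - (\<Sum>j\<le>e. (real j + 2) * g (j + 2))"
    using assms(1) unfolding moment_def add_2_eq_Suc' sum_atMost_Suc_Suc by (simp add: add.commute)
  have "g 0 + g 1 = - (\<Sum>j\<le>e. g (j + 2))"
    using assms(2) unfolding mass_def add_2_eq_Suc' sum_atMost_Suc_Suc by simp
  then have "g 0 = (\<Sum>j\<le>e. (real j + 1) * g (j + 2))"
    unfolding 1 by (simp add: algebra_simps sum.distrib flip: sum_distrib_left)
  then show "sphere_embed e (\<lambda>i. g (i + 2)) i = g i"
  proof -
    consider "i = 0" | "i = 1" | j where "i = j + 2"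
      by (metis One_nat_def add_2_eq_Suc' old.nat.exhaust)
    then show ?thesis
      using 1 \<open>g 0 = _\<close> by cases (simp_all add: sphere_embed_def)
  qed
qed

lemma sphere_embed_scale: "sphere_embed e (\<lambda>i. c * y i) j = c * sphere_embed e y j"
  unfolding sphere_embed_def by (simp add: sum_distrib_left algebra_simps)

section \<open>Equivalence of the region with the unit sphere of the kernel\<close>

abbreviation sphere_points :: "nat \<Rightarrow> (nat \<Rightarrow> real) set"
  where "sphere_points e \<equiv> {y. (\<Sum>i\<le>e. y i ^ 2) = 1 \<and> (\<forall>i>e. y i = 0)}"

text \<open>These are the coordinates of \<open>g - fan (e + 2) g\<close> in the kernel, as
  parametrised by \<open>sphere_embed\<close>.\<close>

definition tail :: "nat \<Rightarrow> (nat \<Rightarrow> real) \<Rightarrow> nat \<Rightarrow> real"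
  where "tail e g i = g (i + 2) - fan (e + 2) g (i + 2)"

definition tail_norm :: "nat \<Rightarrow> (nat \<Rightarrow> real) \<Rightarrow> real"
  where "tail_norm e g = sqrt (\<Sum>i\<le>e. tail e g i ^ 2)"

lemma sphere_embed_tail_fan: "sphere_embed e (tail e g) = (\<lambda>i. g i - fan (e + 2) g i)"
proof -
  let ?w = "\<lambda>i. g i - fan (e + 2) g i"
  have "moment (e + 2) ?w = 0" "mass (e + 2) ?w = 0"
    using moment_linear[of "e + 2" 1 g "-1" "fan (e + 2) g"] mass_linear[of "e + 2" 1 g "-1" "fan (e + 2) g"]
    by (simp_all add: fan_properties)
  then show ?thesis
    using sphere_embed_tail[of e ?w] unfolding tail_def[abs_def] by simp
qed

lemma tail_norm_pos:
  assumes g: "g \<in> cycle_region (e + 2)"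
  shows "0 < tail_norm e g"
proof (rule ccontr)
  assume "\<not> 0 < tail_norm e g"
  then have "(\<Sum>i\<le>e. tail e g i ^ 2) = 0"
    unfolding tail_norm_def by (simp add: not_less sum_nonneg order_antisym)
  then have "\<forall>i\<le>e. tail e g i = 0"
    by (simp add: sum_nonneg_eq_0_iff)
  moreover have "tail e g i = 0" if "e < i" for i
    using that g unfolding tail_def cycle_region_def by (simp add: fan_properties)
  ultimately have "tail e g = (\<lambda>_. 0)"
    by (meson ext not_le)
  then have "g i = fan (e + 2) g i" for i
    using fun_cong[OF sphere_embed_tail_fan[of e g], of i] by (simp add: sphere_embed_def split: if_splits)
  then have "g = fan (e + 2) g"
    by blast
  then show False
    using g fan_properties(1)[of "e + 2" g] by simp
qed

text \<open>The kernel meets the cone only at \<open>0\<close>: cone points are fixed by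
  \<open>fan\<close>, while \<open>fan\<close> sends the kernel to \<open>0\<close>.\<close>

lemma sphere_embed_in_cycle_region:
  assumes y: "y \<in> sphere_points e"
  shows "sphere_embed e y \<in> cycle_region (e + 2)"
proof (rule ccontr)
  assume "sphere_embed e y \<notin> cycle_region (e + 2)"
  moreover have "sphere_embed e y i = 0" if "e + 2 < i" for i
    using y that unfolding sphere_embed_def by auto
  ultimately have "fan (e + 2) (sphere_embed e y) = sphere_embed e y"
    by (intro fan_eq_self) auto
  then have "sphere_embed e y = (\<lambda>_. 0)"
    using fan_null[of "e + 2" "sphere_embed e y"] moment_sphere_embed mass_sphere_embed by simp
  then have "y i = 0" for i
    using fun_cong[of "sphere_embed e y" "\<lambda>_. 0" "i + 2"] unfolding sphere_embed_def by simp
  then show False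
    using y by simp
qed

lemma cycle_region_homotopy_equivalent:
  "top_of_set (cycle_region (e + 2)) homotopy_equivalent_space nsphere e"
proof -
  \<comment> \<open>Project along \<open>fan\<close> to the kernel, then normalise.\<close>
  let ?p = "\<lambda>g i. (1 / tail_norm e g) * tail e g i"
  have coord: "continuous_on S (\<lambda>g. g i)" for i :: nat and S :: "(nat \<Rightarrow> real) set"
    by (rule continuous_on_subset[OF continuous_on_product_coordinates]) auto
  have sphere_embed_p: "sphere_embed e (?p g) i = (1 / tail_norm e g) * (g i - fan (e + 2) g i)" for g i
    unfolding sphere_embed_scale sphere_embed_tail_fan by simp
  have "top_of_set (cycle_region (e + 2)) homotopy_equivalent_space top_of_set (sphere_points e)"
  proof (rule homotopy_equivalent_by_linear)
    have "continuous_on S (\<lambda>g. tail e g i)" for i S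
      unfolding tail_def by (intro continuous_on_diff continuous_on_fan coord)
    then have "continuous_on (cycle_region (e + 2)) (\<lambda>g. ?p g i)" for i
      using tail_norm_pos unfolding tail_norm_def
      by (intro continuous_intros) (auto simp: less_le)
    then show "continuous_on (cycle_region (e + 2)) ?p"
      by (rule continuous_on_coordinatewise_then_product)
    show "?p ` cycle_region (e + 2) \<subseteq> sphere_points e"
    proof clarify
      fix g assume g: "g \<in> cycle_region (e + 2)"
      have "tail_norm e g ^ 2 = (\<Sum>i\<le>e. tail e g i ^ 2)"
        unfolding tail_norm_def by (simp add: sum_nonneg)
      moreover have "(\<Sum>i\<le>e. ?p g i ^ 2) = (1 / tail_norm e g) ^ 2 * (\<Sum>i\<le>e. tail e g i ^ 2)"
        unfolding power_mult_distrib sum_distrib_left ..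
      ultimately have "(\<Sum>i\<le>e. ?p g i ^ 2) = (1 / tail_norm e g) ^ 2 * tail_norm e g ^ 2"
        by metis
      then have "(\<Sum>i\<le>e. ?p g i ^ 2) = 1"
        using tail_norm_pos[OF g] by (simp add: power_divide)
      moreover have "tail e g i = 0" if "e < i" for i
        using that g unfolding tail_def cycle_region_def by (simp add: fan_properties)
      ultimately show "(\<Sum>i\<le>e. ?p g i ^ 2) = 1 \<and> (\<forall>i>e. ?p g i = 0)"
        by simp
    qed
    have "continuous_on (sphere_points e) (\<lambda>y. sphere_embed e y i)" for i
    proof -
      consider "i = 0" | "i = 1" | "2 \<le> i"
        by linarith
      then show ?thesis
        by cases (auto simp: sphere_embed_def intro!: continuous_intros coord)
    qed
    then show "continuous_on (sphere_points e) (sphere_embed e)"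
      by (rule continuous_on_coordinatewise_then_product)
    show "sphere_embed e ` sphere_points e \<subseteq> cycle_region (e + 2)"
      using sphere_embed_in_cycle_region by blast
    show "(\<lambda>i. (1 - \<tau>) * g i + \<tau> * sphere_embed e (?p g) i) \<in> cycle_region (e + 2)"
      if "g \<in> cycle_region (e + 2)" "0 \<le> \<tau>" "\<tau> \<le> 1" for g \<tau>
      unfolding sphere_embed_p using that tail_norm_pos by (intro fan_homotopy) auto
    show "(\<lambda>i. (1 - \<tau>) * y i + \<tau> * ?p (sphere_embed e y) i) \<in> sphere_points e"
      if y: "y \<in> sphere_points e" for y and \<tau> :: real
    proof -
      \<comment> \<open>On the kernel \<open>fan\<close> is zero, so \<open>?p\<close> after
        \<open>sphere_embed\<close> is the identity on the sphere.\<close>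
      have "tail e (sphere_embed e y) = y"
        using fan_null[of "e + 2" "sphere_embed e y"] moment_sphere_embed mass_sphere_embed
        unfolding tail_def[abs_def] by (simp add: sphere_embed_def)
      then have p: "?p (sphere_embed e y) i = y i" for i
        using y unfolding tail_norm_def by simp
      show ?thesis
        unfolding p using y by (simp flip: distrib_right)
    qed
  qed
  then show ?thesis
    unfolding nsphere by (simp only: euclidean_product_topology)
qed

text \<open>The vertices are relabelled by \<open>f\<close>, and constants are divided out by
  subtracting the value at the last vertex. The round trip on \<open>edge_region R\<close> changes a
  function by a constant, which does not affect membership.\<close>

lemma edge_region_homotopy_equivalent_cycle_region:
  fixes f :: "nat \<Rightarrow> 'v"
  assumes f: "bij_betw f {..Suc d} UNIV"
    and R: "\<And>i j. i \<le> Suc d \<Longrightarrow> j \<le> Suc d \<Longrightarrow> i < j \<Longrightarrow>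
      R (f i) (f j) \<longleftrightarrow> j \<noteq> Suc i \<and> \<not> (i = 0 \<and> j = Suc d)"
    and R_sym: "\<And>u w. R u w \<Longrightarrow> R w u" and R_irrefl: "\<And>u. \<not> R u u"
  shows "top_of_set (edge_region R) homotopy_equivalent_space top_of_set (cycle_region d)"
proof -
  define k where "k = inv_into {..Suc d} f"
  have k: "k v \<le> Suc d" "f (k v) = v" for v
    using f inv_into_into[of v f "{..Suc d}"] f_inv_into_f[of v f "{..Suc d}"]
    unfolding k_def bij_betw_def by simp_all
  have kf: "k (f i) = i" if "i \<le> Suc d" for i
    using f that unfolding k_def bij_betw_def by (simp add: inv_into_f_f)
  define F where "F = (\<lambda>(h :: 'v \<Rightarrow> real) i. if i \<le> d then h (f i) - h (f (Suc d)) else 0)"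
  define K where "K = (\<lambda>(g :: nat \<Rightarrow> real) v. g (k v))"
  \<comment> \<open>The formula extends to \<open>i = Suc d\<close>, where both sides are
    \<open>0\<close>.\<close>
  have F: "F h i = h (f i) - h (f (Suc d))" if "i \<le> Suc d" for h i
    using that unfolding F_def by (auto simp: le_Suc_eq)
  have edge_regionI: "h \<in> edge_region R"
    if "u < w" "w \<le> Suc d" "v \<le> Suc d" "w \<noteq> Suc u" "\<not> (u = 0 \<and> w = Suc d)"
      "h (f v) < h (f u)" "h (f v) < h (f w)" for h u w v
  proof -
    have "R (f u) (f w)"
      using that R[of u w] by simp
    then show ?thesis
      using that(6,7) unfolding edge_region_def by blast
  qed
  have edge_regionE: "\<exists>u w v. u < w \<and> w \<le> Suc d \<and> v \<le> Suc d \<and> w \<noteq> Suc u \<and> \<not> (u = 0 \<and> w = Suc d)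
      \<and> h (f v) < h (f u) \<and> h (f v) < h (f w)" if h: "h \<in> edge_region R" for h
  proof -
    obtain u w v where uwv: "R u w" "h v < h u" "h v < h w"
      using h unfolding edge_region_def by blast
    have "u \<noteq> w"
      using uwv(1) R_irrefl by blast
    then have "k u \<noteq> k w"
      using k(2) by metis
    then consider "k u < k w" | "k w < k u"
      by linarith
    then show ?thesis
    proof cases
      case 1
      then show ?thesis
        using R[OF k(1) k(1) 1] uwv k
        by (intro exI[of _ "k u"] exI[of _ "k w"] exI[of _ "k v"]) simp
    next
      case 2
      then show ?thesis
        using R[OF k(1) k(1) 2] R_sym[OF uwv(1)] uwv k
        by (intro exI[of _ "k w"] exI[of _ "k u"] exI[of _ "k v"]) simp
    qed
  qed
  have F_in: "F h \<in> cycle_region d" if "h \<in> edge_region R" for h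
  proof -
    obtain u w v where uwv: "u < w" "w \<le> Suc d" "v \<le> Suc d" "w \<noteq> Suc u" "\<not> (u = 0 \<and> w = Suc d)"
      "h (f v) < h (f u)" "h (f v) < h (f w)"
      using edge_regionE[OF \<open>h \<in> edge_region R\<close>] by (elim exE conjE)
    then have "F h v < F h u" "F h v < F h w"
      by (simp_all add: F)
    then have "\<exists>u w v. u < w \<and> w \<le> Suc d \<and> v \<le> Suc d \<and> w \<noteq> Suc u \<and> \<not> (u = 0 \<and> w = Suc d)
        \<and> F h v < F h u \<and> F h v < F h w"
      using uwv by (intro exI[of _ u] exI[of _ w] exI[of _ v]) simp
    moreover have "F h i = 0" if "d < i" for i
      using that unfolding F_def by simp
    ultimately show ?thesis
      unfolding cycle_region_def by simp
  qed
  have K_in: "K g \<in> edge_region R" if "g \<in> cycle_region d" for g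
  proof -
    obtain u w v where "u < w" "w \<le> Suc d" "v \<le> Suc d" "w \<noteq> Suc u" "\<not> (u = 0 \<and> w = Suc d)"
      "g v < g u" "g v < g w"
      using \<open>g \<in> cycle_region d\<close> unfolding cycle_region_def mem_Collect_eq by (elim exE conjE)
    then show ?thesis
      by (intro edge_regionI[of u w v]) (simp_all add: K_def kf)
  qed
  have KF: "K (F h) v = h v - h (f (Suc d))" for h v
    unfolding K_def using F[OF k(1)] k(2) by simp
  have FK: "F (K g) = g" if "g \<in> cycle_region d" for g
  proof
    show "F (K g) i = g i" for i
      using that kf[of i] kf[of "Suc d"] unfolding F_def K_def cycle_region_def by auto
  qed
  show ?thesis
  proof (rule homotopy_equivalent_by_linear)
    have coord: "continuous_on S (\<lambda>h. h i)" for i :: 'c and S :: "('c \<Rightarrow> real) set"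
      by (rule continuous_on_subset[OF continuous_on_product_coordinates]) auto
    have "continuous_on S (\<lambda>h. F h i)" for S i
      unfolding F_def by (cases "i \<le> d") (auto intro!: continuous_intros coord)
    then show "continuous_on (edge_region R) F"
      by (rule continuous_on_coordinatewise_then_product)
    show "continuous_on (cycle_region d) K"
      unfolding K_def by (intro continuous_on_coordinatewise_then_product) (rule coord)
    show "F ` edge_region R \<subseteq> cycle_region d" "K ` cycle_region d \<subseteq> edge_region R"
      using F_in K_in by blast+
    show "(\<lambda>v. (1 - \<tau>) * h v + \<tau> * K (F h) v) \<in> edge_region R" if "h \<in> edge_region R" for h \<tau>
    proof -
      have "(\<lambda>v. (1 - \<tau>) * h v + \<tau> * K (F h) v) = (\<lambda>v. h v - \<tau> * h (f (Suc d)))"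
        unfolding KF by (simp add: algebra_simps)
      then show ?thesis
        using that unfolding edge_region_def by simp
    qed
    show "(\<lambda>i. (1 - \<tau>) * g i + \<tau> * F (K g) i) \<in> cycle_region d" if "g \<in> cycle_region d" for g and \<tau> :: real
      using that unfolding FK[OF that] by (simp flip: distrib_right)
  qed
qed


section \<open>The lcm-lattice of an edge ideal\<close>

definition squarefree_monom :: "'v::finite set \<Rightarrow> 'v monomial"
  where "squarefree_monom U = Abs_poly_mapping (\<lambda>v. of_bool (v \<in> U))"

lemma lookup_squarefree_monom: "poly_mapping.lookup (squarefree_monom U) v = of_bool (v \<in> U)"
  unfolding squarefree_monom_def by (subst lookup_Abs_poly_mapping) auto

lemma keys_squarefree_monom: "Poly_Mapping.keys (squarefree_monom U) = U"
  by (auto simp: in_keys_iff lookup_squarefree_monom)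

lemma squarefree_monom_empty: "squarefree_monom {} = 0"
  by (intro poly_mapping_eqI) (simp add: lookup_squarefree_monom)

lemma squarefree_monom_eq_iff: "squarefree_monom U = squarefree_monom U' \<longleftrightarrow> U = U'"
  by (metis keys_squarefree_monom)

lemma mon_dvd_iff: "mon_dvd m m' \<longleftrightarrow> (\<forall>v. poly_mapping.lookup m v \<le> poly_mapping.lookup m' v)"
proof
  assume "\<forall>v. poly_mapping.lookup m v \<le> poly_mapping.lookup m' v"
  then have "m' = m + (m' - m)"
    by (intro poly_mapping_eqI) (simp add: lookup_add lookup_minus)
  then show "mon_dvd m m'"
    unfolding mon_dvd_def by blast
qed (auto simp: mon_dvd_def lookup_add)

lemma mon_dvd_antisym: "mon_dvd m m' \<Longrightarrow> mon_dvd m' m \<Longrightarrow> m = m'"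
  unfolding mon_dvd_iff by (intro poly_mapping_eqI) (simp add: order_antisym)

lemma mon_dvd_trans: "mon_dvd m m' \<Longrightarrow> mon_dvd m' m'' \<Longrightarrow> mon_dvd m m''"
  unfolding mon_dvd_iff by (meson order_trans)

lemma mon_dvd_squarefree_monom: "mon_dvd (squarefree_monom U) (squarefree_monom U') \<longleftrightarrow> U \<subseteq> U'"
  unfolding mon_dvd_iff lookup_squarefree_monom by (auto simp: of_bool_def)

lemma mon_lcm_squarefree_monom: "mon_lcm (squarefree_monom ` F) = squarefree_monom (\<Union>F)"
proof -
  have "is_mon_lcm (squarefree_monom ` F) (squarefree_monom (\<Union>F))"
    unfolding is_mon_lcm_def
  proof (intro conjI allI impI ballI)
    show "mon_dvd s (squarefree_monom (\<Union>F))" if "s \<in> squarefree_monom ` F" for s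
      using that by (auto simp: mon_dvd_squarefree_monom)
    show "mon_dvd (squarefree_monom (\<Union>F)) m" if m: "\<forall>s\<in>squarefree_monom ` F. mon_dvd s m" for m
      unfolding mon_dvd_iff
    proof
      fix v
      show "poly_mapping.lookup (squarefree_monom (\<Union>F)) v \<le> poly_mapping.lookup m v"
      proof (cases "v \<in> \<Union>F")
        case True
        then obtain U where "U \<in> F" "v \<in> U"
          by blast
        then have "poly_mapping.lookup (squarefree_monom U) v \<le> poly_mapping.lookup m v"
          using m unfolding mon_dvd_iff by blast
        then show ?thesis
          using True \<open>v \<in> U\<close> by (simp add: lookup_squarefree_monom)
      qed (simp add: lookup_squarefree_monom)
    qed
  qed
  then show ?thesis
    unfolding mon_lcm_def by (intro the_equality) (auto simp: is_mon_lcm_def intro: mon_dvd_antisym)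
qed

lemma mvar_add_mvar:
  fixes i j :: "'v::finite"
  assumes "i \<noteq> j"
  shows "mvar i + mvar j = squarefree_monom {i, j}"
  using assms by (intro poly_mapping_eqI) (auto simp: mvar_def lookup_add lookup_single lookup_squarefree_monom when_def)

lemma edge_monomials_eq:
  fixes E :: "'v::finite set set"
  assumes "simple_graph E"
  shows "edge_monomials E = squarefree_monom ` E"
proof -
  have pair: "mvar i + mvar j = squarefree_monom {i, j}" if "{i, j} \<in> E" for i j
  proof -
    have "card {i, j} = 2"
      using assms that unfolding simple_graph_def by blast
    then show ?thesis
      by (intro mvar_add_mvar) auto
  qed
  show ?thesis
  proof (intro equalityI subsetI)
    fix m assume "m \<in> edge_monomials E"
    then obtain i j where "m = mvar i + mvar j" "{i, j} \<in> E"
      unfolding edge_monomials_def by blast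
    then show "m \<in> squarefree_monom ` E"
      by (simp add: pair)
  next
    fix m assume "m \<in> squarefree_monom ` E"
    then obtain e where e: "m = squarefree_monom e" "e \<in> E"
      by blast
    then have "card e = 2"
      using assms unfolding simple_graph_def by blast
    then obtain i j where "e = {i, j}"
      unfolding card_2_iff by blast
    then show "m \<in> edge_monomials E"
      unfolding edge_monomials_def mem_Collect_eq using e pair by metis
  qed
qed

section \<open>Minimal generators and the open interval\<close>

lemma module_mult: "Modules.module ((*) :: 'a::comm_ring_1 \<Rightarrow> 'a \<Rightarrow> 'a)"
  by unfold_locales (simp_all add: algebra_simps)

lemma edge_ideal_eq:
  fixes E :: "'v set set"
  shows "(edge_ideal E :: ('v, 'k::field) mpoly set) = ideal_gen (monom_poly ` edge_monomials E)"
proof -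
  have "monom_poly (mvar i) * monom_poly (mvar j) = (monom_poly (mvar i + mvar j) :: ('v, 'k) mpoly)" for i j :: 'v
    unfolding monom_poly_def by (simp add: mult_single)
  then have "edge_ideal E = ideal_gen {monom_poly (mvar i + mvar j) :: ('v, 'k) mpoly | i j. {i, j} \<in> E}"
    unfolding edge_ideal_def by simp
  also have "{monom_poly (mvar i + mvar j) :: ('v, 'k) mpoly | i j. {i, j} \<in> E} = monom_poly ` edge_monomials E"
    unfolding edge_monomials_def by blast
  finally show ?thesis .
qed

text \<open>For the forward direction, the polynomials all of whose monomials are divisible by some
  element of \<open>M\<close> form an ideal containing the generators.\<close>

lemma monom_poly_in_ideal_gen_iff:
  fixes M :: "'v monomial set"
  shows "(monom_poly m :: ('v, 'k::field) mpoly) \<in> ideal_gen (monom_poly ` M) \<longleftrightarrow> (\<exists>g\<in>M. mon_dvd g m)"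
proof
  assume m: "(monom_poly m :: ('v, 'k) mpoly) \<in> ideal_gen (monom_poly ` M)"
  define J :: "('v, 'k) mpoly set" where "J = {p. \<forall>m\<in>Poly_Mapping.keys p. \<exists>g\<in>M. mon_dvd g m}"
  have "ideal_gen (monom_poly ` M) \<subseteq> J"
    unfolding ideal_gen_def
  proof (rule module.span_minimal[OF module_mult])
    show "monom_poly ` M \<subseteq> J"
      unfolding J_def monom_poly_def by (auto simp: mon_dvd_iff)
    show "module.subspace (*) J"
      unfolding module.subspace_def[OF module_mult]
    proof (intro conjI ballI allI)
      show "p + q \<in> J" if "p \<in> J" "q \<in> J" for p q
        using that Poly_Mapping.keys_add[of p q] unfolding J_def by blast
      show "c * p \<in> J" if "p \<in> J" for c p
        unfolding J_def
      proof clarify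
        fix a assume "a \<in> Poly_Mapping.keys (c * p)"
        then obtain b b' where b: "a = b + b'" "b' \<in> Poly_Mapping.keys p"
          using Poly_Mapping.keys_mult[of c p] by blast
        then obtain g where "g \<in> M" "mon_dvd g b'"
          using \<open>p \<in> J\<close> unfolding J_def by blast
        moreover have "mon_dvd b' a"
          unfolding b(1) mon_dvd_def by (metis add.commute)
        ultimately show "\<exists>g\<in>M. mon_dvd g a"
          using mon_dvd_trans by blast
      qed
    qed (simp add: J_def)
  qed
  then show "\<exists>g\<in>M. mon_dvd g m"
    using m unfolding J_def monom_poly_def by auto
next
  assume "\<exists>g\<in>M. mon_dvd g m"
  then obtain g q where g: "g \<in> M" "m = q + g"
    unfolding mon_dvd_def by (metis add.commute)
  then have "(monom_poly m :: ('v, 'k) mpoly) = monom_poly q * monom_poly g"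
    unfolding monom_poly_def by (simp add: mult_single)
  then show "(monom_poly m :: ('v, 'k) mpoly) \<in> ideal_gen (monom_poly ` M)"
    using g unfolding ideal_gen_def
    by (simp add: module.span_scale[OF module_mult] module.span_base[OF module_mult])
qed

text \<open>All edges have two vertices, so no edge properly contains another and every generator is
  minimal.\<close>

lemma min_monomial_gens_edge_ideal:
  fixes E :: "'v::finite set set"
  assumes E: "simple_graph E"
  shows "min_monomial_gens (edge_ideal E :: ('v, 'k::field) mpoly set) = squarefree_monom ` E"
proof -
  have mem: "(monom_poly m :: ('v, 'k) mpoly) \<in> edge_ideal E \<longleftrightarrow> (\<exists>e\<in>E. mon_dvd (squarefree_monom e) m)" for m
    unfolding edge_ideal_eq monom_poly_in_ideal_gen_iff edge_monomials_eq[OF E] by simp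
  have refl: "mon_dvd m m" for m :: "'v monomial"
    unfolding mon_dvd_iff by simp
  show ?thesis
    unfolding min_monomial_gens_def mem
  proof (intro equalityI subsetI; clarify)
    fix m e assume "e \<in> E" "mon_dvd (squarefree_monom e) m"
      "\<forall>m'. (\<exists>e\<in>E. mon_dvd (squarefree_monom e) m') \<and> mon_dvd m' m \<longrightarrow> m' = m"
    then show "m \<in> squarefree_monom ` E"
      using refl by blast
  next
    fix e assume e: "e \<in> E"
    have "m = squarefree_monom e"
      if "e' \<in> E" "mon_dvd (squarefree_monom e') m" "mon_dvd m (squarefree_monom e)" for m e'
    proof -
      have "e' \<subseteq> e"
        using that mon_dvd_trans mon_dvd_squarefree_monom by blast
      moreover have "card e' = card e"
        using that e E unfolding simple_graph_def by simp
      ultimately have "e' = e"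
        by (intro card_subset_eq) auto
      then show ?thesis
        using that mon_dvd_antisym by blast
    qed
    then show "(\<exists>e'\<in>E. mon_dvd (squarefree_monom e') (squarefree_monom e)) \<and>
        (\<forall>m'. (\<exists>e\<in>E. mon_dvd (squarefree_monom e) m') \<and> mon_dvd m' (squarefree_monom e) \<longrightarrow> m' = squarefree_monom e)"
      using e refl by blast
  qed
qed

lemma lcm_lattice_edge_ideal:
  fixes E :: "'v::finite set set"
  assumes E: "simple_graph E"
  shows "lcm_lattice (edge_ideal E :: ('v, 'k::field) mpoly set) = {squarefree_monom (\<Union>F) | F. F \<subseteq> E}"
proof -
  have "lcm_lattice (edge_ideal E :: ('v, 'k::field) mpoly set) = mon_lcm ` Pow (squarefree_monom ` E)"
    unfolding lcm_lattice_def min_monomial_gens_edge_ideal[OF E] by auto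
  also have "Pow (squarefree_monom ` E) = (`) squarefree_monom ` Pow E"
    by (simp add: image_Pow_surj)
  finally show ?thesis
    by (auto simp: image_image mon_lcm_squarefree_monom)
qed

lemma union_of_edges_iff:
  assumes E: "simple_graph E"
  shows "(\<exists>F\<subseteq>E. U = \<Union>F) \<longleftrightarrow> (\<forall>u\<in>U. \<exists>w\<in>U. {u, w} \<in> E)"
proof
  assume "\<exists>F\<subseteq>E. U = \<Union>F"
  then obtain F where F: "F \<subseteq> E" "U = \<Union>F"
    by blast
  show "\<forall>u\<in>U. \<exists>w\<in>U. {u, w} \<in> E"
  proof
    fix u assume "u \<in> U"
    then obtain e where e: "e \<in> F" "u \<in> e"
      using F by blast
    then have "card e = 2"
      using E F unfolding simple_graph_def by blast
    then obtain w where "e = {u, w}"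
      using e(2) unfolding card_2_iff by (auto simp: insert_commute)
    then show "\<exists>w\<in>U. {u, w} \<in> E"
      using e F by blast
  qed
next
  assume U: "\<forall>u\<in>U. \<exists>w\<in>U. {u, w} \<in> E"
  then have "U = \<Union>{e\<in>E. e \<subseteq> U}"
    by blast
  then show "\<exists>F\<subseteq>E. U = \<Union>F"
    by (intro exI[of _ "{e\<in>E. e \<subseteq> U}"]) auto
qed

lemma open_interval_edge_ideal:
  fixes E :: "'v::finite set set"
  assumes E: "simple_graph E"
  shows "open_interval mon_dvd (lcm_lattice (edge_ideal E :: ('v, 'k::field) mpoly set)) 0 (mon_lcm (edge_monomials E))
    = squarefree_monom ` {U. U \<noteq> {} \<and> U \<noteq> \<Union>E \<and> (\<forall>u\<in>U. \<exists>w\<in>U. {u, w} \<in> E)}"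
proof -
  have L: "lcm_lattice (edge_ideal E :: ('v, 'k::field) mpoly set)
      = squarefree_monom ` {U. \<forall>u\<in>U. \<exists>w\<in>U. {u, w} \<in> E}"
    unfolding lcm_lattice_edge_ideal[OF E] union_of_edges_iff[OF E, symmetric] by blast
  have "U \<subseteq> \<Union>E" if "\<forall>u\<in>U. \<exists>w\<in>U. {u, w} \<in> E" for U
    using that by blast
  then show ?thesis
    unfolding open_interval_def L edge_monomials_eq[OF E] mon_lcm_squarefree_monom squarefree_monom_empty[symmetric]
    by (auto simp: mon_dvd_squarefree_monom squarefree_monom_eq_iff)
qed

lemma cycle_edges_iff:
  assumes "i < j" "j < n" "3 \<le> n"
  shows "{i, j} \<in> cycle_edges n \<longleftrightarrow> j = Suc i \<or> i = 0 \<and> Suc j = n"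
proof
  assume "{i, j} \<in> cycle_edges n"
  then obtain k where k: "k < n" "{i, j} = {k, (k + 1) mod n}"
    unfolding cycle_edges_def by blast
  then show "j = Suc i \<or> i = 0 \<and> Suc j = n"
    using assms by (cases "Suc k = n") (auto simp: doubleton_eq_iff)
next
  assume "j = Suc i \<or> i = 0 \<and> Suc j = n"
  then show "{i, j} \<in> cycle_edges n"
  proof
    assume "j = Suc i"
    then show ?thesis
      unfolding cycle_edges_def using assms by (intro CollectI exI[of _ i]) simp
  next
    assume "i = 0 \<and> Suc j = n"
    then show ?thesis
      unfolding cycle_edges_def using assms by (intro CollectI exI[of _ j]) auto
  qed
qed

lemma edge_iff_not_cycle_edge:
  assumes E: "simple_graph E" and f: "bij_betw f {..<n} UNIV"
    and compl: "graph_compl E = (\<lambda>e. f ` e) ` cycle_edges n"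
    and ij: "i < j" "j < n" "3 \<le> n"
  shows "{f i, f j} \<in> E \<longleftrightarrow> j \<noteq> Suc i \<and> \<not> (i = 0 \<and> Suc j = n)"
proof -
  have inj: "inj_on f {..<n}"
    using f unfolding bij_betw_def by blast
  have "cycle_edges n \<subseteq> Pow {..<n}"
    using ij unfolding cycle_edges_def by auto
  moreover have "inj_on ((`) f) (Pow {..<n})"
    using inj by (rule inj_on_image_Pow)
  moreover have "{i, j} \<in> Pow {..<n}"
    using ij by auto
  ultimately have "f ` {i, j} \<in> (\<lambda>e. f ` e) ` cycle_edges n \<longleftrightarrow> {i, j} \<in> cycle_edges n"
    by (metis inj_on_image_mem_iff)
  moreover have "f i \<noteq> f j"
    using inj_on_eq_iff[OF inj, of i j] ij by simp
  then have "{f i, f j} \<in> graph_compl E \<longleftrightarrow> {f i, f j} \<notin> E"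
    unfolding graph_compl_def by simp
  ultimately show ?thesis
    unfolding compl cycle_edges_iff[OF ij] by auto
qed


section \<open>Complements of cycles\<close>

text \<open>The only chain is empty, and its coordinates cannot sum to \<open>1\<close>.\<close>

lemma realization_empty_poset: "realization (order_complex r {}) = trivial_topology"
proof -
  have empty: "{t. (\<forall>v. 0 \<le> t v) \<and> {v. t v \<noteq> 0} \<in> order_complex r {} \<and> (\<Sum>v | t v \<noteq> 0. t v) = (1::real)} = {}"
    by (auto simp: order_complex_def)
  then show ?thesis
    unfolding realization_def empty by simp
qed

lemma is_cycleE:
  fixes E :: "'v::finite set set"
  assumes E: "simple_graph E" and n: "3 \<le> n" and cycle: "is_cycle n (graph_compl E)"
  obtains f where "bij_betw f {..<n} (UNIV :: 'v set)"
    "\<And>i j. i < j \<Longrightarrow> j < n \<Longrightarrow> {f i, f j} \<in> E \<longleftrightarrow> j \<noteq> Suc i \<and> \<not> (i = 0 \<and> Suc j = n)"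
proof -
  obtain f where "bij_betw f {..<n} (UNIV :: 'v set)" "graph_compl E = (\<lambda>e. f ` e) ` cycle_edges n"
    using cycle unfolding is_cycle_def by blast
  then show ?thesis
    using that[of f] edge_iff_not_cycle_edge[OF E, of f n] n by simp
qed

text \<open>In a cycle of length three any two vertices are adjacent.\<close>

lemma triangle_complement_empty:
  fixes E :: "'v::finite set set"
  assumes E: "simple_graph E" and cycle: "is_cycle 3 (graph_compl E)"
  shows "E = {}"
proof (rule ccontr)
  assume "E \<noteq> {}"
  then obtain e where "e \<in> E"
    by blast
  then have "card e = 2"
    using E unfolding simple_graph_def by blast
  then obtain u w where e: "e = {u, w}" "u \<noteq> w"
    unfolding card_2_iff by blast
  obtain f where f: "bij_betw f {..<3} (UNIV :: 'v set)"
    "\<And>i j. i < j \<Longrightarrow> j < 3 \<Longrightarrow> {f i, f j} \<in> E \<longleftrightarrow> j \<noteq> Suc i \<and> \<not> (i = 0 \<and> Suc j = 3)"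
    using is_cycleE[OF E _ cycle] by auto
  have no_edge: "{f i, f j} \<notin> E" if "i < j" "j < 3" for i j
    using f(2)[OF that] that by auto
  have "u \<in> f ` {..<3}" "w \<in> f ` {..<3}"
    using f(1) unfolding bij_betw_def by simp_all
  then obtain i j where ij: "i < 3" "j < 3" "u = f i" "w = f j"
    by auto
  then have "i < j \<or> j < i"
    using e(2) by (cases i j rule: linorder_cases) auto
  then have "{u, w} \<notin> E"
    using no_edge[of i j] no_edge[of j i] ij insert_commute[of u w "{}"] by auto
  then show False
    using \<open>e \<in> E\<close> e by simp
qed

lemma realization_homotopy_equivalent_nsphere:
  fixes E :: "'v::finite set set"
  assumes E: "simple_graph E" and cycle: "is_cycle (e + 4) (graph_compl E)"
  shows "realization (order_complex mon_dvd
        (open_interval mon_dvd (lcm_lattice (edge_ideal E :: ('v, 'k::field) mpoly set))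
          0 (mon_lcm (edge_monomials E)))) homotopy_equivalent_space nsphere e"
proof -
  obtain f where f: "bij_betw f {..<e + 4} (UNIV :: 'v set)"
    and adj: "\<And>i j. i < j \<Longrightarrow> j < e + 4 \<Longrightarrow>
      {f i, f j} \<in> E \<longleftrightarrow> j \<noteq> Suc i \<and> \<not> (i = 0 \<and> Suc j = e + 4)"
    using is_cycleE[OF E _ cycle] by auto
  define R where "R = (\<lambda>u w. {u, w} \<in> E)"
  have R_sym: "R w u" if "R u w" for u w
    using that unfolding R_def by (simp add: insert_commute)
  have R_irrefl: "\<not> R u u" for u
    using E unfolding R_def simple_graph_def by force
  have no_isolated: "\<exists>w. R u w" for u
  proof -
    have "u \<in> f ` {..<e + 4}"
      using f unfolding bij_betw_def by simp
    then obtain i where i: "i < e + 4" "u = f i"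
      by auto
    \<comment> \<open>In a cycle of length at least four, vertices two steps apart are not adjacent.
      From the last vertex two steps forward lead to \<open>1\<close>.\<close>
    consider "i + 2 < e + 4" "i \<noteq> 0" | "i = 0" | "2 \<le> i" "i \<noteq> Suc (e + 2)" | "i = Suc (e + 2)"
      by linarith
    then show ?thesis
    proof cases
      case 1
      then show ?thesis
        using adj[of i "i + 2"] i unfolding R_def by auto
    next
      case 2
      then show ?thesis
        using adj[of 0 2] i unfolding R_def by auto
    next
      case 3
      then have "R (f (i - 2)) u"
        using adj[of "i - 2" i] i unfolding R_def by auto
      then show ?thesis
        using R_sym by blast
    next
      case 4
      then have "R (f 1) u"
        using adj[of 1 i] i unfolding R_def by auto
      then show ?thesis
        using R_sym by blast
    qed
  qed
  have "u \<in> \<Union>E" for u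
    using no_isolated[of u] unfolding R_def by blast
  then have union: "\<Union>E = UNIV"
    by blast
  define P where "P = squarefree_monom ` {U. U \<noteq> {} \<and> U \<noteq> UNIV \<and> (\<forall>u\<in>U. \<exists>w\<in>U. R u w)}"
  have P: "open_interval mon_dvd (lcm_lattice (edge_ideal E :: ('v, 'k) mpoly set)) 0 (mon_lcm (edge_monomials E)) = P"
    unfolding open_interval_edge_ideal[OF E] union P_def R_def ..
  interpret union_of_edges_poset R P mon_dvd Poly_Mapping.keys
  proof
    show "mon_dvd x y \<longleftrightarrow> Poly_Mapping.keys x \<subseteq> Poly_Mapping.keys y" if "x \<in> P" "y \<in> P" for x y
      using that unfolding P_def by (auto simp: mon_dvd_squarefree_monom keys_squarefree_monom)
    show "Poly_Mapping.keys ` P = {U. U \<noteq> {} \<and> U \<noteq> UNIV \<and> (\<forall>u\<in>U. \<exists>w\<in>U. R u w)}"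
      unfolding P_def image_image keys_squarefree_monom by simp
    show "finite P"
      unfolding P_def by simp
  qed (fact R_sym no_isolated)+
  \<comment> \<open>Here \<open>d = e + 2\<close>, so the last vertex is
    \<open>d + 1 = e + 3\<close>.\<close>
  have "top_of_set (edge_region R) homotopy_equivalent_space top_of_set (cycle_region (e + 2))"
  proof (rule edge_region_homotopy_equivalent_cycle_region)
    have "{..Suc (e + 2)} = {..<e + 4}"
      by auto
    then show "bij_betw f {..Suc (e + 2)} UNIV"
      using f by simp
    show "R (f i) (f j) \<longleftrightarrow> j \<noteq> Suc i \<and> \<not> (i = 0 \<and> j = Suc (e + 2))"
      if "i \<le> Suc (e + 2)" "j \<le> Suc (e + 2)" "i < j" for i j
      using adj[of i j] that unfolding R_def by auto
  qed (use R_sym R_irrefl in blast)+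
  then show ?thesis
    unfolding P using realization_homotopy_equivalent cycle_region_homotopy_equivalent
    by (blast intro: homotopy_eqv_trans)
qed

theorem theorem4p1:
  fixes n :: nat and E :: "'v::finite set set"
  assumes "n \<ge> 3"
    and "CARD('v) = n"
    and "simple_graph E"
    and "is_cycle n (graph_compl E)"
  shows "\<forall>p::int.
    homology_group p
      (realization (order_complex mon_dvd
        (open_interval mon_dvd (lcm_lattice (edge_ideal E :: ('v, 'k::field) mpoly set))
          0 (mon_lcm (edge_monomials E)))))
    \<cong> homology_group p (unit_sphere (int n - 4))"
proof (cases "n = 3")
  case True
  then have "E = {}"
    using triangle_complement_empty assms by simp
  \<comment> \<open>Without edges there is no nonempty union of edges.\<close>
  then have "open_interval mon_dvd (lcm_lattice (edge_ideal E :: ('v, 'k) mpoly set)) 0 (mon_lcm (edge_monomials E)) = {}"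
    unfolding open_interval_edge_ideal[OF assms(3)] by auto
  moreover have "unit_sphere (int n - 4) = trivial_topology"
    using topspace_unit_sphere_minus_one True by simp
  ultimately have "realization (order_complex mon_dvd
        (open_interval mon_dvd (lcm_lattice (edge_ideal E :: ('v, 'k) mpoly set))
          0 (mon_lcm (edge_monomials E)))) homeomorphic_space unit_sphere (int n - 4)"
    by (simp add: realization_empty_poset homeomorphic_empty_space_eq)
  then show ?thesis
    using homeomorphic_imp_homotopy_equivalent_space
      homotopy_equivalent_space_imp_isomorphic_homology_groups by blast
next
  case False
  define e where "e = n - 4"
  have n: "n = e + 4"
    using False assms(1) unfolding e_def by simp
  have "unit_sphere (int n - 4) = nsphere e"
    using unit_sphere_of_nat[of e] n by simp
  then show ?thesis
    using realization_homotopy_equivalent_nsphere[OF assms(3), of e] assms(4) n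
      homotopy_equivalent_space_imp_isomorphic_homology_groups by auto
qed

end
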